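(* Let $T$ be a countable infinite locally finite rooted tree with infinitely many branching vertices. For $\lambda>0$ let $\ell_\lambda$ be the length function on $T$ with $\ell_\lambda(uv)=\lambda^{|u|}$ for every oriented edge $uv\in E(T)$. Then the branching number of $T$ is the supremum of those $\lambda>0$ for which the normalized factorials of $(T,\ell_\lambda)$ have a finite limit: $$\mathrm{br}(T)=\sup\Bigl\{\lambda>0:\ \lim_{n\to\infty}\tfrac1n\,n!_{(T,\ell_\lambda)}<\infty\Bigr\}.$$
   Context: $T$ has root $\mathfrak r$ and edges oriented away from the root; $|v|$ is the number of edges of the path from $\mathfrak r$ to $v$. A vertex is branching if it has at least two children; a leaf is a vertex $\ne\mathfrak r$ of valence one. A cut-set in $T$ is a set $C$ of vertices such that every infinite oriented path from $\mathfrak r$ meets $C$. The branching number is $$\mathrm{br}(T):=\sup\Bigl\{\lambda>0:\ \inf_{C\ \text{cut-set}}\sum_{v\in C}\lambda^{-|v|}>0\Bigr\}.$$ Factorials of $(T,\ell)$, $\ell:E(T)\to\mathbb R_{+}$ positive: let $\widetilde\partial T$ be the set of all infinite oriented paths from $\mathfrak r$ together with all oriented paths from $\mathfrak r$ to a leaf; for distinct $\rho,\tau\in\widetilde\partial T$ let $\langle\rho,\tau\rangle$ be the sum of $\ell(e)$ over common edges. Choose $\rho_0\in\widetilde\partial T$ arbitrarily; given $\rho_0,\dots,\rho_{n-1}$ choose $\rho_n\in\widetilde\partial T\setminus\{\rho_0,\dots,\rho_{n-1}\}$ minimizing $\sum_{j<n}\langle\rho,\rho_j\rangle$; then $n!_{(T,\ell)}:=\sum_{j<n}\langle\rho_n,\rho_j\rangle$,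 independent of choices. If $T$ has infinitely many branching vertices, the sequence is infinite and $\frac1n n!_{(T,\ell)}$ converges in $(0,\infty]$. *)

theory Defs
  imports "HOL-Analysis.Analysis" "Graph_Theory.Pair_Digraph"
begin

text \<open>
  A rooted tree with its edges oriented away from the root is a digraph in which every vertex is
  reached from the root by exactly one directed walk. (The predicate \<open>tree\<close> of
  \<open>Digraph_Component\<close> excludes directed cycles only, so it also admits digraphs whose
  underlying undirected graph has cycles.)
\<close>

locale rooted_tree = pair_wf_digraph T for T :: "'a pair_pre_digraph" +
  fixes r :: 'a
  assumes root_in_verts: "r \<in> pverts T"
    and unique_awalk: "\<And>v. v \<in> pverts T \<Longrightarrow> \<exists>!p. awalk r p v"

text \<open>The notation \<open>|v|\<close>.\<close>

definition depth :: "'a pair_pre_digraph \<Rightarrow> 'a \<Rightarrow> 'a \<Rightarrow> nat" where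
  "depth T r v = length (THE p. pre_digraph.awalk T r p v)"

definition locally_finite :: "'a pair_pre_digraph \<Rightarrow> bool" where
  "locally_finite T \<longleftrightarrow> (\<forall>v \<in> pverts T. finite (in_arcs T v \<union> out_arcs T v))"

definition branching :: "'a pair_pre_digraph \<Rightarrow> 'a \<Rightarrow> bool" where
  "branching T v \<longleftrightarrow> v \<in> pverts T \<and> out_degree T v \<ge> 2"

definition leaf :: "'a pair_pre_digraph \<Rightarrow> 'a \<Rightarrow> 'a \<Rightarrow> bool" where
  "leaf T r v \<longleftrightarrow> v \<in> pverts T \<and> v \<noteq> r \<and> card (in_arcs T v \<union> out_arcs T v) = 1"

definition ray :: "'a pair_pre_digraph \<Rightarrow> 'a \<Rightarrow> (nat \<Rightarrow> 'a) \<Rightarrow> bool" where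
  "ray T r f \<longleftrightarrow> f 0 = r \<and> (\<forall>i. (f i, f (Suc i)) \<in> parcs T)"

definition cut_set :: "'a pair_pre_digraph \<Rightarrow> 'a \<Rightarrow> 'a set \<Rightarrow> bool" where
  "cut_set T r C \<longleftrightarrow> C \<subseteq> pverts T \<and> (\<forall>f. ray T r f \<longrightarrow> range f \<inter> C \<noteq> {})"

text \<open>
  Cut-sets may be infinite, so the sums are taken in \<open>[0, \<infinity>]\<close>. The branching number may be
  infinite, so it is an extended real.
\<close>

definition branching_number :: "'a pair_pre_digraph \<Rightarrow> 'a \<Rightarrow> ereal" where
  "branching_number T r =
    Sup (ereal ` {lam. lam > 0 \<and>
      (INF C \<in> {C. cut_set T r C}. \<Sum>\<^sub>\<infinity> v \<in> C. ennreal (lam powi (- int (depth T r v)))) > 0})"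

text \<open>
  A nonempty oriented path starting at the root is determined by its set of edges, and is
  represented by it. The edges common to two paths are then the intersection of the two sets,
  which is finite when the paths are distinct elements of the following set.
\<close>

definition extended_boundary :: "'a pair_pre_digraph \<Rightarrow> 'a \<Rightarrow> ('a \<times> 'a) set set" where
  "extended_boundary T r =
    {range (\<lambda>i. (f i, f (Suc i))) | f. ray T r f} \<union>
    {set p | p v. leaf T r v \<and> pre_digraph.awalk T r p v}"

definition common_length :: "('a \<times> 'a \<Rightarrow> real) \<Rightarrow> ('a \<times> 'a) set \<Rightarrow> ('a \<times> 'a) set \<Rightarrow> real" where
  "common_length l \<rho> \<tau> = (\<Sum>e \<in> \<rho> \<inter> \<tau>. l e)"

text \<open>For \<open>n = 0\<close> the minimized sum is empty, so \<open>\<rho> 0\<close> is arbitrary.\<close>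

definition greedy_sequence ::
    "'a pair_pre_digraph \<Rightarrow> 'a \<Rightarrow> ('a \<times> 'a \<Rightarrow> real) \<Rightarrow> (nat \<Rightarrow> ('a \<times> 'a) set) \<Rightarrow> bool" where
  "greedy_sequence T r l \<rho> \<longleftrightarrow>
    (\<forall>n. is_arg_min (\<lambda>\<tau>. \<Sum>j<n. common_length l \<tau> (\<rho> j))
           (\<lambda>\<tau>. \<tau> \<in> extended_boundary T r - \<rho> ` {..<n}) (\<rho> n))"

text \<open>
  The value does not depend on which greedy sequence is chosen. When the tree has infinitely many
  branching vertices and is locally finite, infinite greedy sequences exist.
\<close>

definition tree_factorial ::
    "'a pair_pre_digraph \<Rightarrow> 'a \<Rightarrow> ('a \<times> 'a \<Rightarrow> real) \<Rightarrow> nat \<Rightarrow> real" where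
  "tree_factorial T r l n =
    (let \<rho> = (SOME \<rho>. greedy_sequence T r l \<rho>) in \<Sum>j<n. common_length l (\<rho> n) (\<rho> j))"

definition geometric_length :: "'a pair_pre_digraph \<Rightarrow> 'a \<Rightarrow> real \<Rightarrow> 'a \<times> 'a \<Rightarrow> real" where
  "geometric_length T r lam = (\<lambda>(u, v). lam ^ depth T r u)"

end

theory Submission
  imports Defs
begin

text \<open>
  For distinct paths the common length is an ultrametric kernel. A greedy matching argument for such
  kernels shows that the factorials are superadditive, so their averages converge as soon as they
  are bounded.

  If the factorials are at most \<open>M n\<close>, at most \<open>1 + M n / \<lambda>\<^sup>|\<^sup>u\<^sup>|\<close> of the first \<open>n\<close> greedy paths
  use the arc \<open>uv\<close>. Since all but boundedly many of them cross a given cut-set, letting \<open>n\<close> tend to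
  infinity bounds its sum from below. Conversely, let the cut-set sums for some \<open>\<mu> > \<lambda>\<close> be bounded
  away from \<open>0\<close>. The vertices \<open>v\<close> that more than \<open>K n \<mu>\<^sup>-\<^sup>|\<^sup>v\<^sup>|\<close> of the first \<open>n\<close> greedy paths visit
  contain an antichain whose sum is at most \<open>1 / K\<close>. For large \<open>K\<close> they cannot form a cut-set, so
  some ray avoids them, and its total common length with these paths is at most
  \<open>K n \<Sum>\<^sub>k \<lambda>\<^sup>k \<mu>\<^sup>-\<^sup>k\<^sup>-\<^sup>1\<close>, which is linear in \<open>n\<close>.
\<close>

section \<open>Greedy sequences for an ultrametric kernel\<close>

text \<open>Larger \<open>s\<close> means closer, so the strong triangle inequality is reversed. It
  is asked of distinct points only, since the common length of a ray with itself is the default 0 of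
  an infinite sum. \<open>attained\<close> provides minima over infinite sets of candidates.\<close>

locale ultrametric_kernel =
  fixes S :: "'b set" and s :: "'b \<Rightarrow> 'b \<Rightarrow> real"
  assumes sym: "s x y = s y x"
    and nonneg: "x \<in> S \<Longrightarrow> y \<in> S \<Longrightarrow> 0 \<le> s x y"
    and ultra: "x \<in> S \<Longrightarrow> y \<in> S \<Longrightarrow> z \<in> S \<Longrightarrow> x \<noteq> y \<Longrightarrow> y \<noteq> z \<Longrightarrow> x \<noteq> z \<Longrightarrow>
      min (s x y) (s y z) \<le> s x z"
    and attained: "y \<in> S \<Longrightarrow> X \<subseteq> S - {y} \<Longrightarrow> X \<noteq> {} \<Longrightarrow> \<exists>x\<in>X. \<forall>x'\<in>X. s x y \<le> s x' y"
begin

definition greedy :: "(nat \<Rightarrow> 'b) \<Rightarrow> bool" where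
  "greedy \<rho> \<longleftrightarrow>
    (\<forall>n. is_arg_min (\<lambda>x. \<Sum>j<n. s x (\<rho> j)) (\<lambda>x. x \<in> S - \<rho> ` {..<n}) (\<rho> n))"

text \<open>Sort the candidates by the point of \<open>F\<close> nearest to them. Within one class a
  single candidate minimizes every term at once, and there are only finitely many classes.\<close>

lemma attained_sum:
  assumes F: "finite F" "F \<subseteq> S" and X: "X \<subseteq> S - F" "X \<noteq> {}"
  shows "\<exists>x\<in>X. \<forall>x'\<in>X. (\<Sum>y\<in>F. s x y) \<le> (\<Sum>y\<in>F. s x' y)"
proof (cases "F = {}")
  case True
  then show ?thesis using X by auto
next
  case False
  define near where "near j = {x \<in> X. \<forall>i\<in>F. s x i \<le> s x j}" for j
  have cover: "\<exists>j\<in>F. x \<in> near j" if "x \<in> X" for x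
  proof -
    obtain j where j: "j \<in> F" "Max (s x ` F) = s x j"
      using Max_in[of "s x ` F"] F False by (metis finite_imageI image_iff image_is_empty)
    have "\<forall>i\<in>F. s x i \<le> s x j"
      unfolding j(2)[symmetric] using F by simp
    then show ?thesis using that j(1) unfolding near_def by blast
  qed
  have "\<exists>x\<in>near j. \<forall>x'\<in>near j. (\<Sum>y\<in>F. s x y) \<le> (\<Sum>y\<in>F. s x' y)"
    if j: "j \<in> F" "near j \<noteq> {}" for j
  proof -
    obtain x where x: "x \<in> near j" "\<And>x'. x' \<in> near j \<Longrightarrow> s x j \<le> s x' j"
    proof -
      have "j \<in> S" "near j \<subseteq> S - {j}" using j F X by (auto simp: near_def)
      then show ?thesis using attained[of j "near j"] j that by blast
    qed
    \<comment> \<open>As \<open>j\<close> is nearest to \<open>x\<close>, \<open>s x i\<close> is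
      bounded by both \<open>s x j\<close> and \<open>s j i\<close>. By the choice of
      \<open>x\<close> and the ultrametric inequality, the minimum of these two is at most
      \<open>s x' i\<close>.\<close>
    have "s x i \<le> s x' i" if x': "x' \<in> near j" and i: "i \<in> F" for x' i
    proof (cases "i = j")
      case True
      then show ?thesis using x x' by auto
    next
      case False
      have "i \<in> S" "j \<in> S" "x \<in> S" "x' \<in> S" "x \<noteq> i" "x \<noteq> j" "x' \<noteq> i" "x' \<noteq> j"
        using x x' i j F X by (auto simp: near_def)
      then have "min (s x j) (s x i) \<le> s j i" "min (s x' j) (s j i) \<le> s x' i"
        using ultra[of j x i] ultra[of x' j i] False by (auto simp: sym[of j x])
      moreover have "s x i \<le> s x j" using x i by (auto simp: near_def)
      moreover have "s x j \<le> s x' j" using x x' by auto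
      ultimately show ?thesis by linarith
    qed
    then show ?thesis using x by (intro bexI[of _ x] ballI sum_mono) auto
  qed
  then obtain g where g: "\<And>j. j \<in> F \<Longrightarrow> near j \<noteq> {} \<Longrightarrow>
      g j \<in> near j \<and> (\<forall>x'\<in>near j. (\<Sum>y\<in>F. s (g j) y) \<le> (\<Sum>y\<in>F. s x' y))"
    by metis
  define G where "G = g ` {j \<in> F. near j \<noteq> {}}"
  have "finite G" "G \<noteq> {}" using F cover X by (auto simp: G_def)
  then obtain x where x: "x \<in> G" "\<And>z. z \<in> G \<Longrightarrow> (\<Sum>y\<in>F. s x y) \<le> (\<Sum>y\<in>F. s z y)"
    using ex_is_arg_min_if_finite[of G "\<lambda>x. \<Sum>y\<in>F. s x y"]
    by (auto simp: is_arg_min_def not_less)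
  show ?thesis
  proof (rule bexI[of _ x], rule ballI)
    fix x' assume "x' \<in> X"
    then obtain j where j: "j \<in> F" "x' \<in> near j" using cover by auto
    then have "(\<Sum>y\<in>F. s (g j) y) \<le> (\<Sum>y\<in>F. s x' y)" using g by auto
    moreover have "g j \<in> G" using j by (auto simp: G_def)
    ultimately show "(\<Sum>y\<in>F. s x y) \<le> (\<Sum>y\<in>F. s x' y)" using x(2)[of "g j"] by simp
  next
    show "x \<in> X" using x g by (auto simp: G_def near_def)
  qed
qed

lemma ex_greedy:
  assumes "infinite S"
  shows "\<exists>\<rho>. greedy \<rho>"
proof -
  define P where "P F x \<longleftrightarrow> is_arg_min (\<lambda>x. \<Sum>y\<in>F. s x y) (\<lambda>x. x \<in> S - F) x" for F x
  have step: "\<exists>x. P F x" if "finite F" "F \<subseteq> S" for F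
    using attained_sum[OF that, of "S - F"] assms that
    by (auto simp: P_def is_arg_min_def not_less Diff_eq_empty_iff dest: finite_subset)
  define g where "g F = (SOME x. P F x)" for F
  have g: "P F (g F)" if "finite F" "F \<subseteq> S" for F
    unfolding g_def using step[OF that] by (rule someI_ex)
  \<comment> \<open>The choice \<open>g\<close> depends only on the set of points chosen so far, so
    the recursion runs over sets. Injectivity of \<open>\<rho>\<close> later turns sums over
    \<open>A n\<close> into sums over indices.\<close>
  define A where "A n = ((\<lambda>F. insert (g F) F) ^^ n) {}" for n
  define \<rho> where "\<rho> n = g (A n)" for n
  have A_Suc: "A (Suc n) = insert (\<rho> n) (A n)" for n by (simp add: A_def \<rho>_def)
  have A_eq: "A n = \<rho> ` {..<n}" for n
    by (induction n) (simp_all add: A_Suc lessThan_Suc, simp add: A_def)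
  have A: "A n \<subseteq> S \<and> inj_on \<rho> {..<n}" for n
  proof (induction n)
    case (Suc n)
    then have "P (A n) (\<rho> n)" unfolding \<rho>_def using A_eq[of n] by (intro g) auto
    then have "\<rho> n \<in> S - \<rho> ` {..<n}" by (auto simp: P_def is_arg_min_def A_eq)
    then show ?case using Suc by (auto simp: A_Suc lessThan_Suc)
  qed (simp add: A_def)
  have "greedy \<rho>" unfolding greedy_def
  proof
    fix n
    have "P (A n) (\<rho> n)" unfolding \<rho>_def using A[of n] A_eq[of n] by (intro g) auto
    then show "is_arg_min (\<lambda>x. \<Sum>j<n. s x (\<rho> j)) (\<lambda>x. x \<in> S - \<rho> ` {..<n}) (\<rho> n)"
      using A[of n] by (simp add: P_def A_eq sum.reindex)
  qed
  then show ?thesis by blast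
qed

text \<open>Discard a closest pair \<open>(y, f i)\<close> and use induction: for the surviving
  \<open>x\<close>, the term \<open>s x (f i)\<close> is at most \<open>s x y\<close>, so every term
  on the left is matched with one at least as large on the right. \<open>f\<close> need not be
  injective, so that a point may count repeatedly.\<close>

lemma ex_matching_point:
  assumes "finite I" "finite Y" "Y \<subseteq> S" "f ` I \<subseteq> S" "card Y = Suc (card I)"
  shows "\<exists>x\<in>Y. x \<notin> f ` I \<and> (\<Sum>i\<in>I. s x (f i)) \<le> (\<Sum>y\<in>Y - {x}. s x y)"
  using assms
proof (induction "card I" arbitrary: I Y)
  case 0
  then obtain x where "Y = {x}" by (auto simp: card_Suc_eq)
  then show ?case using 0 by auto
next
  case (Suc n)
  have ne: "I \<noteq> {}" "Y \<noteq> {}" using Suc by auto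
  \<comment> \<open>With the convention that \<open>s x x = \<infinity>\<close>, the pair \<open>(y, f i)\<close> maximizes \<open>s\<close>.\<close>
  obtain i y where iy: "i \<in> I" "y \<in> Y"
    and max: "y = f i \<or> (Y \<inter> f ` I = {} \<and> (\<forall>i'\<in>I. \<forall>y'\<in>Y. s y' (f i') \<le> s y (f i)))"
  proof (cases "Y \<inter> f ` I = {}")
    case False
    then show ?thesis using that by auto
  next
    case True
    have "finite (I \<times> Y)" "I \<times> Y \<noteq> {}" using Suc ne by auto
    then obtain p where p: "is_arg_min (\<lambda>(i, y). - s y (f i)) (\<lambda>p. p \<in> I \<times> Y) p"
      using ex_is_arg_min_if_finite by blast
    obtain i y where "p = (i, y)" by (cases p)
    then have "i \<in> I \<and> y \<in> Y \<and> (\<forall>i'\<in>I. \<forall>y'\<in>Y. s y' (f i') \<le> s y (f i))"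
      using p by (auto simp: is_arg_min_def not_less)
    then show ?thesis using that True by blast
  qed
  have "\<exists>x\<in>Y - {y}. x \<notin> f ` (I - {i}) \<and>
      (\<Sum>i'\<in>I - {i}. s x (f i')) \<le> (\<Sum>y'\<in>(Y - {y}) - {x}. s x y')"
    using Suc iy by (intro Suc.hyps) auto
  then obtain x where x: "x \<in> Y" "x \<noteq> y" "x \<notin> f ` (I - {i})"
    and le: "(\<Sum>i'\<in>I - {i}. s x (f i')) \<le> (\<Sum>y'\<in>(Y - {y}) - {x}. s x y')"
    by auto
  \<comment> \<open>If \<open>y \<noteq> f i\<close>, maximality gives
    \<open>s x (f i) \<le> s y (f i)\<close>, so the minimum in the ultrametric inequality is
    \<open>s x (f i)\<close>.\<close>
  have "x \<noteq> f i \<and> s x (f i) \<le> s x y"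
  proof (cases "y = f i")
    case False
    then have "x \<noteq> f i" "s x (f i) \<le> s y (f i)" "f i \<in> S" "x \<in> S" "y \<in> S"
      using max x iy Suc.prems by auto
    then show ?thesis using ultra[of x "f i" y] x False by (auto simp: sym[of "f i" y])
  qed (use x in auto)
  moreover have "(\<Sum>i\<in>I. s x (f i)) = s x (f i) + (\<Sum>i'\<in>I - {i}. s x (f i'))"
    using Suc.prems iy by (intro sum.remove) auto
  moreover have "(\<Sum>y\<in>Y - {x}. s x y) = s x y + (\<Sum>y'\<in>(Y - {y}) - {x}. s x y')"
    using Suc.prems iy x by (subst sum.remove[of _ y]) (auto intro!: sum.cong)
  ultimately show ?case using x le by (intro bexI[of _ x]) auto
qed

end

section \<open>Superadditivity of greedy costs and convergence of their averages\<close>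

locale greedy_kernel = ultrametric_kernel S s
  for S :: "'b set" and s :: "'b \<Rightarrow> 'b \<Rightarrow> real" +
  fixes \<rho> :: "nat \<Rightarrow> 'b"
  assumes greedy: "greedy \<rho>"
begin

definition cost :: "nat \<Rightarrow> real" where
  "cost n = (\<Sum>j<n. s (\<rho> n) (\<rho> j))"

lemma \<rho>_in: "\<rho> n \<in> S"
  using greedy by (auto simp: greedy_def is_arg_min_def)

lemma inj_\<rho>: "inj \<rho>"
proof (rule linorder_injI)
  fix i j :: nat assume "i < j"
  have "\<rho> j \<notin> \<rho> ` {..<j}" using greedy by (auto simp: greedy_def is_arg_min_def)
  then show "\<rho> i \<noteq> \<rho> j" using \<open>i < j\<close> by (metis imageI lessThan_iff)
qed

lemma cost_le: "x \<in> S \<Longrightarrow> x \<notin> \<rho> ` {..<n} \<Longrightarrow> cost n \<le> (\<Sum>j<n. s x (\<rho> j))"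
  using greedy unfolding greedy_def is_arg_min_def cost_def
  by (metis (no_types, lifting) DiffI not_less)

lemma cost_nonneg: "0 \<le> cost n"
  by (simp add: cost_def sum_nonneg nonneg \<rho>_in)

text \<open>
  Passing from \<open>\<rho> i\<close> to the nearest later point does not decrease the total: for the indices below
  \<open>i\<close> this is the greedy choice, for the others it is the ultrametric inequality.
\<close>

lemma total_le_cost:
  assumes "i \<le> k"
  shows "(\<Sum>j\<in>{..k} - {i}. s (\<rho> i) (\<rho> j)) \<le> cost k"
  using assms
proof (induction "k - i" arbitrary: i rule: less_induct)
  case less
  show ?case
  proof (cases "i = k")
    case True
    then have "{..k} - {i} = {..<k}" by auto
    then show ?thesis using True by (simp add: cost_def)
  next
    case False
    have "finite {i<..k}" "{i<..k} \<noteq> {}" using False less by auto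
    then obtain l where "is_arg_min (\<lambda>l. - s (\<rho> i) (\<rho> l)) (\<lambda>l. l \<in> {i<..k}) l"
      using ex_is_arg_min_if_finite by blast
    then have l: "i < l" "l \<le> k"
      and near: "\<And>j. i < j \<Longrightarrow> j \<le> k \<Longrightarrow> s (\<rho> i) (\<rho> j) \<le> s (\<rho> i) (\<rho> l)"
      by (auto simp: is_arg_min_def not_less)
    have \<rho>_neq: "\<rho> a \<noteq> \<rho> b" if "a \<noteq> b" for a b using inj_\<rho> that by (auto dest: injD)
    have low: "(\<Sum>j<i. s (\<rho> i) (\<rho> j)) \<le> (\<Sum>j<i. s (\<rho> l) (\<rho> j))"
      using cost_le[of "\<rho> l" i] \<rho>_in \<rho>_neq l by (force simp: cost_def)
    have high: "s (\<rho> i) (\<rho> j) \<le> s (\<rho> l) (\<rho> j)" if "j \<in> {i<..k} - {l}" for j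
      using ultra[of "\<rho> l" "\<rho> i" "\<rho> j"] near[of j] that l \<rho>_in \<rho>_neq
      by (auto simp: sym[of "\<rho> l" "\<rho> i"])
    have split: "(\<Sum>j\<in>{..k} - {a}. g j) = (\<Sum>j<i. g j) + (\<Sum>j\<in>{i<..k} - {l}. g j) + g b"
      if "(a, b) = (i, l) \<or> (a, b) = (l, i)" for a b and g :: "nat \<Rightarrow> real"
    proof -
      have "{..k} - {a} = ({..<i} \<union> ({i<..k} - {l})) \<union> {b}" using l that by auto
      moreover have "({..<i} \<union> ({i<..k} - {l})) \<inter> {b} = {}" "{..<i} \<inter> ({i<..k} - {l}) = {}"
        using l that by auto
      ultimately show ?thesis by (simp only: sum.union_disjoint finite_Un finite_lessThan
          finite_greaterThanAtMost finite_Diff finite.intros simp_thms) simp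
    qed
    have "(\<Sum>j\<in>{..k} - {i}. s (\<rho> i) (\<rho> j))
        = (\<Sum>j<i. s (\<rho> i) (\<rho> j)) + (\<Sum>j\<in>{i<..k} - {l}. s (\<rho> i) (\<rho> j)) + s (\<rho> i) (\<rho> l)"
      by (rule split) simp
    also have "\<dots> \<le> (\<Sum>j<i. s (\<rho> l) (\<rho> j)) + (\<Sum>j\<in>{i<..k} - {l}. s (\<rho> l) (\<rho> j)) + s (\<rho> l) (\<rho> i)"
      by (intro add_mono sum_mono low high) (simp_all add: sym[of "\<rho> l" "\<rho> i"])
    also have "\<dots> = (\<Sum>j\<in>{..k} - {l}. s (\<rho> l) (\<rho> j))"
      by (rule split[symmetric]) simp
    also have "\<dots> \<le> cost k" using less l by auto
    finally show ?thesis .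
  qed
qed

text \<open>Match the first \<open>m + n + 1\<close> greedy points against the initial segments of
  lengths \<open>m\<close> and \<open>n\<close> together. The point \<open>x\<close> found lies
  outside both, so its sums over them are at least \<open>cost m\<close> and \<open>cost n\<close>;
  its total over the other points is controlled by \<open>total_le_cost\<close>.\<close>

lemma cost_superadditive: "cost m + cost n \<le> cost (m + n)"
proof -
  define f where "f = case_sum \<rho> \<rho>"
  \<comment> \<open>A disjoint sum, because the shorter segment is contained in the longer one and
    its points must count twice.\<close>
  define I :: "(nat + nat) set" where "I = {..<m} <+> {..<n}"
  have cY: "card (\<rho> ` {..m + n}) = Suc (card I)"
    using inj_\<rho> by (simp add: I_def card_Plus card_image inj_on_subset)
  have fI: "f ` I = \<rho> ` {..<m} \<union> \<rho> ` {..<n}"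
    by (auto simp: I_def f_def Plus_def image_Un image_image)
  have "finite I" by (simp add: I_def)
  then obtain x where x: "x \<in> \<rho> ` {..m + n}" "x \<notin> f ` I"
    and le: "(\<Sum>i\<in>I. s x (f i)) \<le> (\<Sum>y\<in>\<rho> ` {..m + n} - {x}. s x y)"
    using ex_matching_point[of I "\<rho> ` {..m + n}" f] cY \<rho>_in by (auto simp: fI)
  obtain i where i: "i \<le> m + n" "x = \<rho> i" using x by auto
  have "cost m + cost n \<le> (\<Sum>j<m. s x (\<rho> j)) + (\<Sum>j<n. s x (\<rho> j))"
    using x \<rho>_in by (intro add_mono cost_le) (auto simp: fI)
  also have "\<dots> = (\<Sum>i\<in>I. s x (f i))" by (simp add: I_def f_def sum.Plus comp_def)
  also note le
  also have "\<rho> ` {..m + n} - {x} = \<rho> ` ({..m + n} - {i})"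
    using inj_\<rho> i by (auto dest: injD)
  also have "(\<Sum>y\<in>\<rho> ` ({..m + n} - {i}). s x y) = (\<Sum>j\<in>{..m + n} - {i}. s (\<rho> i) (\<rho> j))"
    using inj_\<rho> i by (subst sum.reindex) (auto intro: inj_on_subset)
  also have "\<dots> \<le> cost (m + n)" by (rule total_le_cost) (rule i)
  finally show ?thesis .
qed

lemma cost_mono: "m \<le> n \<Longrightarrow> cost m \<le> cost n"
  using cost_superadditive[of m "n - m"] cost_nonneg[of "n - m"] by simp

lemma cost_mult: "real q * cost m \<le> cost (q * m)"
proof (induction q)
  case (Suc q)
  then show ?case using cost_superadditive[of m "q * m"] by (simp add: algebra_simps)
qed (simp add: cost_nonneg)

text \<open>Fekete's lemma for superadditive sequences: the limit is the supremum of the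
  averages.\<close>

lemma cost_div_convergent:
  assumes bound: "\<And>n. cost n \<le> M * real n"
  shows "\<exists>L. (\<lambda>n. cost n / real n) \<longlonglongrightarrow> L"
proof -
  define L where "L = (SUP n\<in>{1..}. cost n / real n)"
  have bdd: "bdd_above ((\<lambda>n. cost n / real n) ` {1..})"
    using bound by (intro bdd_aboveI2[of _ _ M]) (auto simp: field_simps)
  have upper: "cost n / real n \<le> L" if "n \<ge> 1" for n
    unfolding L_def using that by (intro cSUP_upper bdd) auto
  have "(\<lambda>n. cost n / real n) \<longlonglongrightarrow> L"
  proof (rule order_tendstoI)
    fix a assume "L < a"
    then show "\<forall>\<^sub>F n in sequentially. cost n / real n < a"
      using upper by (intro eventually_sequentiallyI[of 1]) (meson le_less_trans)
  next
    fix a assume "a < L"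
    then obtain m where m: "m \<ge> 1" "a < cost m / real m"
      using less_cSUP_iff[OF _ bdd] unfolding L_def by auto
    \<comment> \<open>Rounding \<open>n\<close> down to a multiple of \<open>m\<close> loses at most
      \<open>cost m\<close> against growth at rate \<open>cost m / m\<close>, which is negligible
      after division by \<open>n\<close>.\<close>
    have "(\<lambda>n. cost m / real m - cost m / real n) \<longlonglongrightarrow> cost m / real m - 0"
      by (intro tendsto_intros lim_const_over_n)
    then have "\<forall>\<^sub>F n in sequentially. a < cost m / real m - cost m / real n"
      using m by (intro order_tendstoD) auto
    moreover have "\<forall>\<^sub>F n in sequentially. cost m / real m - cost m / real n \<le> cost n / real n"
    proof (rule eventually_sequentiallyI[of 1])
      fix n :: nat assume n: "1 \<le> n"
      have "real n \<le> real m * (real (n div m) + 1)"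
      proof -
        have "n \<le> m * (n div m + 1)"
          using m by (metis Suc_eq_plus1 dividend_less_times_div less_imp_le_nat mult_Suc_right
              add.commute zero_less_one less_le_trans)
        then show ?thesis by (metis of_nat_mono of_nat_mult of_nat_add of_nat_1)
      qed
      then have "(real n / real m - 1) * cost m \<le> real (n div m) * cost m"
        using m cost_nonneg by (intro mult_right_mono) (auto simp: field_simps)
      also have "\<dots> \<le> cost (n div m * m)" by (rule cost_mult)
      also have "\<dots> \<le> cost n" by (intro cost_mono) simp
      finally have "(real n / real m - 1) * cost m / real n \<le> cost n / real n"
        by (rule divide_right_mono) simp
      moreover have "(real n / real m - 1) * cost m / real n = cost m / real m - cost m / real n"
        using m n by (simp add: field_simps)
      ultimately show "cost m / real m - cost m / real n \<le> cost n / real n" by simp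
    qed
    ultimately show "\<forall>\<^sub>F n in sequentially. a < cost n / real n"
      by eventually_elim simp
  qed
  then show ?thesis ..
qed

end

section \<open>Paths in a rooted tree\<close>

lemma ray_Suc: "ray T r f \<Longrightarrow> (f i, f (Suc i)) \<in> parcs T"
  by (simp add: ray_def)

context rooted_tree
begin

abbreviation level :: "'a \<Rightarrow> nat" where
  "level \<equiv> depth T r"

abbreviation boundary :: "('a \<times> 'a) set set" where
  "boundary \<equiv> extended_boundary T r"

definition pth :: "'a \<Rightarrow> ('a \<times> 'a) list" where
  "pth v = (THE p. awalk r p v)"

lemma level_eq: "level v = length (pth v)"
  by (simp add: depth_def pth_def)

lemma awalk_pth: "v \<in> pverts T \<Longrightarrow> awalk r (pth v) v"
  unfolding pth_def using unique_awalk by (rule theI')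

lemma pth_unique: "awalk r p v \<Longrightarrow> pth v = p"
  using unique_awalk[of v] awalk_pth[of v] awalk_last_in_verts[of r p v] by blast

lemma pth_root [simp]: "pth r = []"
  by (rule pth_unique) (simp add: awalk_Nil_iff root_in_verts)

lemma level_root [simp]: "level r = 0"
  by (simp add: level_eq)

lemma pth_arc:
  assumes "(v, w) \<in> parcs T"
  shows "pth w = pth v @ [(v, w)]"
proof -
  have "awalk v [(v, w)] w" using arc_implies_awalk[OF assms] by simp
  then have "awalk r (pth v @ [(v, w)]) w"
    by (rule awalk_appendI[OF awalk_pth[OF in_arcsD1[OF assms]]])
  then show ?thesis by (rule pth_unique)
qed

lemma level_arc: "(v, w) \<in> parcs T \<Longrightarrow> level w = Suc (level v)"
  by (simp add: level_eq pth_arc)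

lemma arc_parent_unique: "(u, w) \<in> parcs T \<Longrightarrow> (v, w) \<in> parcs T \<Longrightarrow> u = v"
  using pth_arc[of u w] pth_arc[of v w] by simp

lemma arc_not_root: "(u, v) \<in> parcs T \<Longrightarrow> v \<noteq> r"
  using level_arc[of u v] by auto

lemma pth_subset: "v \<in> pverts T \<Longrightarrow> set (pth v) \<subseteq> parcs T"
  using awalk_pth by (auto simp: awalk_def)

lemma pth_prefix:
  assumes "v \<in> pverts T" "e \<in> set (pth v)"
  shows "\<exists>q. pth v = pth (snd e) @ q"
proof -
  obtain p q where p: "pth v = p @ e # q" using assms split_list by metis
  have "awalk r (p @ e # q) v" using awalk_pth[OF assms(1)] by (simp only: p)
  then obtain w where w: "awalk r p w" "awalk w (e # q) v"
    unfolding awalk_append_iff by blast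
  then have e: "e \<in> parcs T" "w = fst e" unfolding awalk_Cons_iff by blast+
  have "pth (fst e) = p" using w e pth_unique by blast
  then have "pth (snd e) = p @ [e]"
    using pth_arc[of "fst e" "snd e"] e by simp
  then show ?thesis using p by simp
qed

lemma arc_in_pth: "e \<in> parcs T \<Longrightarrow> e \<in> set (pth (snd e))"
  using pth_arc[of "fst e" "snd e"] by simp

lemma pth_nested:
  assumes v: "v \<in> pverts T" and e: "e \<in> set (pth v)" "e' \<in> set (pth v)"
    and le: "level (snd e) \<le> level (snd e')"
  shows "e \<in> set (pth (snd e'))"
proof -
  obtain q q' where q: "pth v = pth (snd e) @ q" "pth v = pth (snd e') @ q'"
    using pth_prefix v e by metis
  have "pth (snd e) = take (level (snd e)) (pth v)" by (simp add: q(1) level_eq)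
  also have "\<dots> = take (level (snd e)) (pth (snd e'))"
    using le by (simp only: q(2)) (simp add: level_eq)
  finally have "pth (snd e) = take (level (snd e)) (pth (snd e'))" .
  moreover have "e \<in> set (pth (snd e))" using arc_in_pth pth_subset[OF v] e(1) by blast
  ultimately show ?thesis by (metis in_set_takeD)
qed

text \<open>A common description of finite and infinite oriented paths from the root, as arc sets
  closed under ancestors and linearly ordered by them. It avoids separate arguments for rays and
  leaves.\<close>

definition path_set :: "('a \<times> 'a) set \<Rightarrow> bool" where
  "path_set x \<longleftrightarrow> x \<subseteq> parcs T \<and> (\<forall>e\<in>x. set (pth (snd e)) \<subseteq> x) \<and>
    (\<forall>e\<in>x. \<forall>e'\<in>x. level (snd e) \<le> level (snd e') \<longrightarrow> e \<in> set (pth (snd e')))"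

lemma path_setD:
  assumes "path_set x" "e \<in> x"
  shows "e \<in> parcs T" "set (pth (snd e)) \<subseteq> x"
    and "e' \<in> x \<Longrightarrow> level (snd e') \<le> level (snd e) \<Longrightarrow> e' \<in> set (pth (snd e))"
proof -
  note x = assms(1)[unfolded path_set_def]
  show "e \<in> parcs T" by (rule subsetD[OF conjunct1[OF x] assms(2)])
  show "set (pth (snd e)) \<subseteq> x" by (rule bspec[OF conjunct1[OF conjunct2[OF x]] assms(2)])
  show "e' \<in> x \<Longrightarrow> level (snd e') \<le> level (snd e) \<Longrightarrow> e' \<in> set (pth (snd e))"
    by (rule mp[OF bspec[OF bspec[OF conjunct2[OF conjunct2[OF x]]] assms(2)]])
qed

lemma path_set_pth:
  assumes v: "v \<in> pverts T"
  shows "path_set (set (pth v))"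
proof -
  have "set (pth (snd e)) \<subseteq> set (pth v)" if e: "e \<in> set (pth v)" for e
    using pth_prefix[OF v e] by auto
  then show ?thesis using pth_subset[OF v] pth_nested[OF v] by (auto simp: path_set_def)
qed

lemma path_set_level_inj:
  assumes x: "path_set x" and e: "e \<in> x" "e' \<in> x" and eq: "level (snd e) = level (snd e')"
  shows "e = e'"
proof -
  have arcs: "e \<in> parcs T" "e' \<in> parcs T" using x e path_setD by blast+
  then have "snd e' \<in> pverts T" using in_arcsD2[of "fst e'" "snd e'"] by simp
  moreover have "e \<in> set (pth (snd e'))" using path_setD(3)[OF x e(2,1)] eq by simp
  ultimately obtain q where "pth (snd e') = pth (snd e) @ q" using pth_prefix by blast
  then have "pth (snd e') = pth (snd e)" using eq by (simp add: level_eq)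
  then show ?thesis using pth_arc[of "fst e" "snd e"] pth_arc[of "fst e'" "snd e'"] arcs by simp
qed

text \<open>The source of the ultrametric inequality: both intersections are initial segments of
  \<open>x\<close>, hence comparable.\<close>

lemma path_set_nested:
  assumes x: "path_set x" "path_set y" "path_set z"
  shows "x \<inter> y \<subseteq> z \<or> x \<inter> z \<subseteq> y"
proof (rule ccontr)
  assume "\<not> ?thesis"
  then obtain e e' where e: "e \<in> x" "e \<in> y" "e \<notin> z" "e' \<in> x" "e' \<in> z" "e' \<notin> y" by blast
  have "e \<in> z" if "level (snd e) \<le> level (snd e')"
    using path_setD(3)[OF x(1) e(4,1) that] path_setD(2)[OF x(3) e(5)] by blast
  moreover have "e' \<in> y" if "level (snd e') \<le> level (snd e)"
    using path_setD(3)[OF x(1) e(1,4) that] path_setD(2)[OF x(2) e(2)] by blast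
  ultimately show False using e by linarith
qed

lemma pth_ray:
  assumes f: "ray T r f"
  shows "pth (f k) = map (\<lambda>i. (f i, f (Suc i))) [0..<k]"
  by (induction k) (use f in \<open>simp_all add: ray_def pth_arc[OF ray_Suc[OF f]]\<close>)

lemma level_ray: "ray T r f \<Longrightarrow> level (f k) = k"
  by (simp add: level_eq pth_ray)

lemma ray_in_verts: "ray T r f \<Longrightarrow> f k \<in> pverts T"
  using in_arcsD1 ray_Suc by metis

lemma path_set_ray:
  assumes f: "ray T r f"
  shows "path_set (range (\<lambda>i. (f i, f (Suc i))))"
proof -
  have pth: "set (pth (f (Suc j))) = (\<lambda>i. (f i, f (Suc i))) ` {..j}" for j
    by (simp add: pth_ray[OF f] atLeast0LessThan lessThan_Suc_atMost del: upt_Suc)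
  show ?thesis
    unfolding path_set_def using ray_Suc[OF f]
    by (simp add: pth level_ray[OF f] image_subset_iff)
qed

lemma boundary_cases:
  assumes "x \<in> boundary"
  obtains f where "ray T r f" "x = range (\<lambda>i. (f i, f (Suc i)))"
  | v where "leaf T r v" "v \<in> pverts T" "x = set (pth v)"
proof -
  consider f where "ray T r f" "x = range (\<lambda>i. (f i, f (Suc i)))"
    | p v where "leaf T r v" "awalk r p v" "x = set p"
    using assms unfolding extended_boundary_def by blast
  then show ?thesis
    using that pth_unique awalk_last_in_verts by cases blast+
qed

lemma ray_in_boundary: "ray T r f \<Longrightarrow> range (\<lambda>i. (f i, f (Suc i))) \<in> boundary"
  by (auto simp: extended_boundary_def)

lemma path_set_boundary: "x \<in> boundary \<Longrightarrow> path_set x"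
  by (elim boundary_cases) (auto intro: path_set_ray path_set_pth)

text \<open>Infinitely many common arcs include arbitrarily late ones, and each brings along the
  whole walk leading to it.\<close>

lemma infinite_path_set_subset:
  assumes f: "ray T r f" and y: "path_set y"
    and inf: "infinite (range (\<lambda>i. (f i, f (Suc i))) \<inter> y)"
  shows "range (\<lambda>i. (f i, f (Suc i))) \<subseteq> y"
proof safe
  fix i
  define e where "e i = (f i, f (Suc i))" for i
  have "range (\<lambda>i. (f i, f (Suc i))) \<inter> y = e ` {k. e k \<in> y}" by (auto simp: e_def)
  then have "infinite (e ` {k. e k \<in> y})" using inf by simp
  then have "infinite {k. e k \<in> y}" by blast
  then obtain k where k: "i \<le> k" "e k \<in> y" unfolding infinite_nat_iff_unbounded_le by blast
  have "e i \<in> set (pth (snd (e k)))" using k by (auto simp: e_def pth_ray[OF f] simp del: upt_Suc)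
  then show "(f i, f (Suc i)) \<in> y" using path_setD(2)[OF y k(2)] by (auto simp: e_def)
qed

lemma infinite_boundary_ray:
  "x \<in> boundary \<Longrightarrow> infinite x \<Longrightarrow> \<exists>f. ray T r f \<and> x = range (\<lambda>i. (f i, f (Suc i)))"
  by (elim boundary_cases) auto

text \<open>An infinite intersection would force both elements to be rays, each contained in the
  other. Hence \<open>common_length\<close> of distinct elements is a genuine finite sum.\<close>

lemma finite_boundary_Int:
  assumes x: "x \<in> boundary" "y \<in> boundary" "x \<noteq> y"
  shows "finite (x \<inter> y)"
proof (rule ccontr)
  assume inf: "infinite (x \<inter> y)"
  then have "infinite x" "infinite y" by auto
  then obtain f g where f: "ray T r f" "x = range (\<lambda>i. (f i, f (Suc i)))"
      and g: "ray T r g" "y = range (\<lambda>i. (g i, g (Suc i)))"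
    using x infinite_boundary_ray by meson
  have "x \<subseteq> y"
    using infinite_path_set_subset[OF f(1) path_set_boundary[OF x(2)]] inf f(2) by simp
  moreover have "y \<subseteq> x"
    using infinite_path_set_subset[OF g(1) path_set_boundary[OF x(1)]] inf g(2)
    by (simp add: Int_commute)
  ultimately show False using x by simp
qed

section \<open>Koenig's lemma and infinitude of the boundary\<close>

lemma reachable_root: "v \<in> pverts T \<Longrightarrow> (r, v) \<in> (parcs T)\<^sup>*"
proof (induction "level v" arbitrary: v)
  case 0
  then show ?case using awalk_pth[of v] by (auto simp: level_eq awalk_Nil_iff)
next
  case (Suc n)
  then obtain p e where p: "pth v = p @ [e]"
    by (metis level_eq length_0_conv nat.distinct(1) rev_exhaust)
  have "awalk r (p @ [e]) v" using awalk_pth[OF Suc(3)] by (simp only: p)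
  then obtain u where "awalk u [e] v" unfolding awalk_append_iff by blast
  then have "e \<in> parcs T" "snd e = v" by (simp_all add: awalk_Cons_iff awalk_Nil_iff)
  then have e: "(fst e, v) \<in> parcs T" by auto
  then have "(r, fst e) \<in> (parcs T)\<^sup>*"
    using Suc(1)[of "fst e"] Suc(2) in_arcsD1[OF e] level_arc[OF e] by simp
  then show ?case using e by (rule rtrancl_into_rtrancl)
qed

lemma rtrancl_level:
  assumes "(v, w) \<in> (parcs T)\<^sup>*"
  shows "level v < level w \<or> v = w"
  using assms by (induction rule: rtrancl_induct) (auto simp: level_arc)

lemma finite_children:
  assumes "locally_finite T" "v \<in> pverts T"
  shows "finite {w. (v, w) \<in> parcs T}"
proof -
  have "finite (out_arcs T v)" using assms by (auto simp: locally_finite_def)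
  then have "finite (snd ` out_arcs T v)" by simp
  then show ?thesis by (rule rev_finite_subset) (force simp: out_arcs_def)
qed

text \<open>Koenig's lemma inside an ancestor-closed set: by local finiteness, a vertex with
  infinitely many descendants in \<open>X\<close> has a child of the same kind.\<close>

lemma koenig:
  assumes lf: "locally_finite T"
    and X: "X \<subseteq> pverts T" "infinite X"
    and closed: "\<And>v w. (v, w) \<in> parcs T \<Longrightarrow> w \<in> X \<Longrightarrow> v \<in> X"
  shows "\<exists>f. ray T r f \<and> range f \<subseteq> X"
proof -
  define big where "big v \<longleftrightarrow> infinite {w \<in> X. (v, w) \<in> (parcs T)\<^sup>*}" for v
  have big_in: "v \<in> X" if "big v" for v
  proof -
    obtain w where "(v, w) \<in> (parcs T)\<^sup>*" "w \<in> X"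
      using \<open>big v\<close> not_finite_existsD unfolding big_def by blast
    then show ?thesis by (induction rule: converse_rtrancl_induct) (auto intro: closed)
  qed
  have "{w \<in> X. (r, w) \<in> (parcs T)\<^sup>*} = X" using X reachable_root by auto
  then have "big r" using X by (simp add: big_def)
  have step: "\<exists>c. big c \<and> (v, c) \<in> parcs T" if "big v" for v
  proof (rule ccontr)
    assume "\<not> ?thesis"
    moreover have "finite {w. (v, w) \<in> parcs T}"
      using finite_children[OF lf] big_in[OF that] X by auto
    ultimately have "finite (insert v (\<Union>c\<in>{c. (v, c) \<in> parcs T}. {w \<in> X. (c, w) \<in> (parcs T)\<^sup>*}))"
      by (auto simp: big_def)
    moreover have "{w \<in> X. (v, w) \<in> (parcs T)\<^sup>*} \<subseteq>
        insert v (\<Union>c\<in>{c. (v, c) \<in> parcs T}. {w \<in> X. (c, w) \<in> (parcs T)\<^sup>*})"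
      by (auto elim: converse_rtranclE)
    ultimately show False using that finite_subset unfolding big_def by blast
  qed
  obtain f where "f 0 = r" "\<And>n. big (f n)" "\<And>n. (f n, f (Suc n)) \<in> parcs T"
    using dependent_nat_choice[of "\<lambda>n v. big v \<and> (n = 0 \<longrightarrow> v = r)" "\<lambda>n v w. (v, w) \<in> parcs T"]
      \<open>big r\<close> step by auto
  then show ?thesis using big_in by (auto simp: ray_def)
qed

lemma child_exists:
  assumes lf: "locally_finite T" and v: "v \<in> pverts T" "v \<noteq> r" "\<not> leaf T r v"
  shows "\<exists>w. (v, w) \<in> parcs T"
proof (rule ccontr)
  assume "\<nexists>w. (v, w) \<in> parcs T"
  then have "out_arcs T v = {}" by (auto simp: out_arcs_def)
  moreover obtain u where "(u, v) \<in> parcs T"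
    using reachable_root[OF v(1)] v(2) by (auto elim: rtranclE)
  then have "in_arcs T v = {(u, v)}" by (auto simp: in_arcs_def arc_parent_unique)
  ultimately show False using v by (simp add: leaf_def)
qed

text \<open>A leaf reachable from \<open>c\<close> gives a finite path through the arc. Without one,
  every vertex reachable from \<open>c\<close> has a child, and the walk to \<open>c\<close> extends
  to a ray.\<close>

lemma boundary_through_arc:
  assumes lf: "locally_finite T" and arc: "(v, c) \<in> parcs T"
  shows "\<exists>x\<in>boundary. (v, c) \<in> x"
proof (cases "\<exists>w. (c, w) \<in> (parcs T)\<^sup>* \<and> leaf T r w")
  case True
  then obtain w where w: "(c, w) \<in> (parcs T)\<^sup>*" "leaf T r w" by auto
  have "(v, c) \<in> set (pth w)" using w(1)
    by (induction rule: rtrancl_induct) (simp_all add: pth_arc[OF arc] pth_arc)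
  moreover have "set (pth w) \<in> boundary"
    using w awalk_pth[of w] unfolding extended_boundary_def leaf_def by blast
  ultimately show ?thesis by blast
next
  case False
  have cV: "c \<in> pverts T" using arc in_arcsD2 by blast
  \<comment> \<open>The vertices of level \<open>n\<close> comparable with \<open>c\<close>. A ray
    through such vertices must be at \<open>c\<close> on the level of \<open>c\<close>, and hence
    uses the arc \<open>(v, c)\<close>.\<close>
  define P where "P n w \<longleftrightarrow> level w = n \<and> w \<in> pverts T \<and>
    ((w, c) \<in> (parcs T)\<^sup>* \<or> (c, w) \<in> (parcs T)\<^sup>*)" for n w
  have P0: "P 0 r" using reachable_root cV root_in_verts by (auto simp: P_def)
  have step: "\<exists>u. P (Suc n) u \<and> (w, u) \<in> parcs T" if w: "P n w" for n w
  proof (cases "(c, w) \<in> (parcs T)\<^sup>*")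
    case True
    have "w \<in> pverts T" "w \<noteq> r"
      using w rtrancl_level[OF True] level_arc[OF arc] by (auto simp: P_def)
    then obtain u where u: "(w, u) \<in> parcs T"
      using child_exists[OF lf, of w] False True by blast
    then have "(c, u) \<in> (parcs T)\<^sup>*" using True by (simp add: rtrancl_into_rtrancl)
    then show ?thesis using w u level_arc[OF u] in_arcsD2[OF u] unfolding P_def by blast
  next
    case False
    then have "(w, c) \<in> (parcs T)\<^sup>*" "w \<noteq> c" using w unfolding P_def by blast+
    then obtain u where u: "(w, u) \<in> parcs T" "(u, c) \<in> (parcs T)\<^sup>*"
      by (blast elim: converse_rtranclE)
    then show ?thesis using w level_arc[OF u(1)] in_arcsD2[OF u(1)] unfolding P_def by blast
  qed
  obtain f where f: "f 0 = r" "\<And>n. P n (f n)" "\<And>n. (f n, f (Suc n)) \<in> parcs T"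
    using dependent_nat_choice[of "\<lambda>n v. P n v \<and> (n = 0 \<longrightarrow> v = r)" "\<lambda>n v w. (v, w) \<in> parcs T"]
      P0 step by auto
  then have ray: "ray T r f" by (simp add: ray_def)
  define u where "u = f (Suc (level v))"
  have "P (Suc (level v)) u" unfolding u_def by (rule f)
  then have "level u = level c" "(u, c) \<in> (parcs T)\<^sup>* \<or> (c, u) \<in> (parcs T)\<^sup>*"
    using level_arc[OF arc] unfolding P_def by simp_all
  then have "u = c" using rtrancl_level[of u c] rtrancl_level[of c u] by auto
  moreover have "(f (level v), u) \<in> parcs T" unfolding u_def by (rule f)
  ultimately have "f (level v) = v" using arc_parent_unique arc by blast
  then have "(v, c) \<in> range (\<lambda>i. (f i, f (Suc i)))"
    using \<open>u = c\<close> unfolding u_def by (intro image_eqI[of _ _ "level v"]) simp_all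
  then show ?thesis by (rule bexI[OF _ ray_in_boundary[OF ray]])
qed

text \<open>A branching vertex is where two boundary elements separate, and the pair determines this
  vertex. A finite boundary has only finitely many pairs.\<close>

lemma infinite_boundary:
  assumes lf: "locally_finite T" and br: "infinite {v. branching T v}"
  shows "infinite boundary"
proof
  assume fin: "finite boundary"
  define splits where "splits v p \<longleftrightarrow> fst p \<in> boundary \<and> snd p \<in> boundary \<and>
    (\<exists>c d. c \<noteq> d \<and> (v, c) \<in> fst p \<and> (v, d) \<in> snd p)" for v p
  have ex: "\<exists>p. splits v p" if "branching T v" for v
  proof -
    have "2 \<le> card (out_arcs T v)" using that by (auto simp: branching_def out_degree_def)
    then obtain e e' where "e \<in> out_arcs T v" "e' \<in> out_arcs T v" "e \<noteq> e'"
      by (metis card_le_Suc0_iff_eq card.infinite not_less_eq_eq numeral_2_eq_2 zero_le)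
    then obtain c d where "(v, c) \<in> parcs T" "(v, d) \<in> parcs T" "c \<noteq> d"
      by (cases e; cases e') (auto simp: out_arcs_def)
    then show ?thesis
      using boundary_through_arc[OF lf] unfolding splits_def by (metis fst_conv snd_conv)
  qed
  then obtain g where g: "\<And>v. branching T v \<Longrightarrow> splits v (g v)" by metis
  \<comment> \<open>If \<open>v\<close> were strictly nearer to the root than \<open>w\<close>, both
    paths would leave \<open>v\<close> before reaching \<open>w\<close>, so \<open>(v, c)\<close>
    and \<open>(v, d)\<close> would both lie on the single walk to \<open>w\<close>.\<close>
  have level_le: "level v = level w"
    if sp: "splits v p" "splits w p" and le: "level v \<le> level w" for v w p
  proof (rule ccontr)
    assume "level v \<noteq> level w"
    obtain c d where c: "c \<noteq> d" "(v, c) \<in> fst p" "(v, d) \<in> snd p"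
      using sp(1) unfolding splits_def by blast
    obtain c' d' where c': "(w, c') \<in> fst p" "(w, d') \<in> snd p"
      using sp(2) unfolding splits_def by blast
    have ps: "path_set (fst p)" "path_set (snd p)"
      using sp(1) path_set_boundary unfolding splits_def by blast+
    note arcs = path_setD(1)[OF ps(1) c(2)] path_setD(1)[OF ps(2) c(3)]
      path_setD(1)[OF ps(1) c'(1)] path_setD(1)[OF ps(2) c'(2)]
    note lev = arcs[THEN level_arc]
    have "(v, c) \<in> set (pth c')" "(v, d) \<in> set (pth d')"
      using path_setD(3)[OF ps(1) c'(1) c(2)] path_setD(3)[OF ps(2) c'(2) c(3)] le
      by (simp_all add: lev)
    then have "(v, c) \<in> set (pth w)" "(v, d) \<in> set (pth w)"
      using \<open>level v \<noteq> level w\<close> unfolding pth_arc[OF arcs(3)] pth_arc[OF arcs(4)] by auto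
    then have "(v, c) = (v, d)"
      by (rule path_set_level_inj[OF path_set_pth[OF in_arcsD1[OF arcs(3)]]]) (simp add: lev)
    then show False using c by simp
  qed
  have eq: "v = w" if sp: "splits v p" "splits w p" for v w p
  proof -
    have lev: "level v = level w" using level_le[OF sp] level_le[OF sp(2,1)] by linarith
    obtain c c' where c: "(v, c) \<in> fst p" "(w, c') \<in> fst p" "path_set (fst p)"
      using sp path_set_boundary unfolding splits_def by blast
    note arcs = path_setD(1)[OF c(3,1)] path_setD(1)[OF c(3,2)]
    have "(v, c) = (w, c')"
      by (rule path_set_level_inj[OF c(3,1,2)]) (simp add: arcs[THEN level_arc] lev)
    then show ?thesis by simp
  qed
  have sub: "g ` {v. branching T v} \<subseteq> boundary \<times> boundary"
  proof (rule image_subsetI)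
    fix v assume "v \<in> {v. branching T v}"
    then have "splits v (g v)" by (simp add: g)
    then show "g v \<in> boundary \<times> boundary" by (simp add: splits_def mem_Times_iff)
  qed
  have "inj_on g {v. branching T v}"
  proof (rule inj_onI)
    fix v w assume v: "v \<in> {v. branching T v}" "w \<in> {v. branching T v}" "g v = g w"
    have "splits v (g v)" "splits w (g w)" using v(1,2) by (simp_all add: g)
    then show "v = w" using eq[of v "g v" w] v(3) by simp
  qed
  moreover have "finite (g ` {v. branching T v})"
    by (rule finite_subset[OF sub]) (intro finite_cartesian_product fin)
  ultimately show False using br finite_imageD by blast
qed

section \<open>Cut-sets\<close>

text \<open>The first elements of \<open>C\<close> on the way from the root. Heads of arcs are never
  \<open>r\<close>, so only non-root vertices shadow others, and the non-root elements form an
  antichain.\<close>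

definition min_cut :: "'a set \<Rightarrow> 'a set" where
  "min_cut C = {v \<in> C. \<forall>e\<in>set (pth v). snd e \<in> C \<longrightarrow> snd e = v}"

lemma min_cut_subset: "min_cut C \<subseteq> C"
  by (auto simp: min_cut_def)

lemma cut_set_min_cut:
  assumes C: "cut_set T r C"
  shows "cut_set T r (min_cut C)"
  unfolding cut_set_def
proof (intro conjI allI impI)
  show "min_cut C \<subseteq> pverts T" using C by (auto simp: min_cut_def cut_set_def)
  fix f assume f: "ray T r f"
  have "\<exists>k. f k \<in> C" using C f by (auto simp: cut_set_def)
  define k where "k = (LEAST k. f k \<in> C)"
  have fk: "f k \<in> C" unfolding k_def using \<open>\<exists>k. f k \<in> C\<close> by (rule LeastI_ex)
  have least: "k \<le> j" if "f j \<in> C" for j unfolding k_def using that by (rule Least_le)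
  have "snd e = f k" if e: "e \<in> set (pth (f k))" "snd e \<in> C" for e
  proof -
    obtain i where i: "i < k" "e = (f i, f (Suc i))" using e(1) by (auto simp: pth_ray[OF f])
    then have "k \<le> Suc i" using e(2) least[of "Suc i"] by simp
    then have "Suc i = k" using i by simp
    then show ?thesis using i by auto
  qed
  then have "f k \<in> min_cut C" using fk by (simp add: min_cut_def)
  then show "range f \<inter> min_cut C \<noteq> {}" by blast
qed

lemma min_cut_arc_unique:
  assumes x: "path_set x" and e: "e \<in> x" "e' \<in> x" "snd e \<in> min_cut C" "snd e' \<in> min_cut C"
  shows "e = e'"
proof -
  have "snd e = snd e'"
  proof (cases "level (snd e) \<le> level (snd e')")
    case True
    then show ?thesis using path_setD(3)[OF x e(2,1)] e by (auto simp: min_cut_def)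
  next
    case False
    then show ?thesis using path_setD(3)[OF x e(1,2)] e by (auto simp: min_cut_def)
  qed
  then show ?thesis using path_set_level_inj[OF x e(1,2)] by simp
qed

text \<open>The heads of the arcs of \<open>pth v\<close> include \<open>v\<close> itself unless
  \<open>v = r\<close>, so these vertices lie strictly above \<open>C\<close>. The root always
  belongs, so the case \<open>r \<in> C\<close> is treated apart.\<close>

definition above_cut :: "'a set \<Rightarrow> 'a set" where
  "above_cut C = {v \<in> pverts T. \<forall>e\<in>set (pth v). snd e \<notin> C}"

text \<open>Otherwise Koenig's lemma would give a ray staying above the cut and thus missing
  \<open>C\<close>.\<close>

lemma finite_above_cut:
  assumes lf: "locally_finite T" and C: "cut_set T r C" "r \<notin> C"
  shows "finite (above_cut C)"
proof (rule ccontr)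
  assume "infinite (above_cut C)"
  moreover have "v \<in> above_cut C" if "(v, w) \<in> parcs T" "w \<in> above_cut C" for v w
    using that in_arcsD1 by (auto simp: above_cut_def pth_arc)
  ultimately obtain f where f: "ray T r f" "range f \<subseteq> above_cut C"
    using koenig[OF lf, of "above_cut C"] by (auto simp: above_cut_def)
  have "range f \<inter> C \<noteq> {}" using C f unfolding cut_set_def by blast
  then obtain k where k: "f k \<in> C" by blast
  then obtain i where i: "k = Suc i" using f C by (cases k) (auto simp: ray_def)
  have "(f i, f k) \<in> set (pth (f k))" using ray_Suc[OF f(1), of i] i by (simp add: pth_arc)
  moreover have "f k \<in> above_cut C" using f(2) by blast
  ultimately show False using k by (auto simp: above_cut_def)
qed

text \<open>Each minimal element is a child of one of the finitely many vertices above the cut. This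
  reduces a possibly infinite cut-set to a finite one.\<close>

lemma finite_min_cut:
  assumes lf: "locally_finite T" and C: "cut_set T r C" "r \<notin> C"
  shows "finite (min_cut C)"
proof -
  have "min_cut C \<subseteq> (\<Union>v\<in>above_cut C. {w. (v, w) \<in> parcs T})"
  proof
    fix w assume w: "w \<in> min_cut C"
    then have wV: "w \<in> pverts T" "w \<noteq> r" using C by (auto simp: min_cut_def cut_set_def)
    then obtain v where v: "(v, w) \<in> parcs T"
      using reachable_root[of w] by (auto elim: rtranclE)
    have "snd e \<notin> C" if e: "e \<in> set (pth v)" for e
    proof
      assume "snd e \<in> C"
      then have "snd e = w" using w e v by (auto simp: min_cut_def pth_arc)
      moreover obtain q where "pth v = pth (snd e) @ q"
        using pth_prefix e in_arcsD1[OF v] by blast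
      ultimately show False using pth_arc[OF v] by simp
    qed
    then have "v \<in> above_cut C" using in_arcsD1[OF v] by (simp add: above_cut_def)
    then show "w \<in> (\<Union>v\<in>above_cut C. {w. (v, w) \<in> parcs T})" using v by blast
  qed
  moreover have "finite (\<Union>v\<in>above_cut C. {w. (v, w) \<in> parcs T})"
    using finite_above_cut[OF assms] finite_children[OF lf] by (auto simp: above_cut_def)
  ultimately show ?thesis by (rule finite_subset)
qed

text \<open>An earliest head in \<open>C\<close> along the path would be minimal, so a path avoiding
  the minimal elements never reaches \<open>C\<close>. This will confine such paths to a finite set
  of arcs.\<close>

lemma path_set_above_cut:
  assumes x: "path_set x" and avoid: "\<And>e. e \<in> x \<Longrightarrow> snd e \<notin> min_cut C"
  shows "x \<subseteq> above_cut C \<times> above_cut C"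
proof -
  have out: "snd e \<notin> C" if "e \<in> x" for e
    using that
  proof (induction "level (snd e)" arbitrary: e rule: less_induct)
    case less
    show ?case
    proof
      assume "snd e \<in> C"
      then obtain e' where e': "e' \<in> set (pth (snd e))" "snd e' \<in> C" "snd e' \<noteq> snd e"
        using avoid[OF less.prems] by (auto simp: min_cut_def)
      have "snd e \<in> pverts T" using path_setD(1)[OF x less.prems] in_arcsD2[of "fst e"] by simp
      then obtain q where q: "pth (snd e) = pth (snd e') @ q" using pth_prefix e' by blast
      have e'x: "e' \<in> x" using path_setD(2)[OF x less.prems] e' by blast
      then have "level (snd e') \<noteq> level (snd e)"
        using path_set_level_inj[OF x e'x less.prems] e' by blast
      then have "level (snd e') < level (snd e)" using q by (simp add: level_eq)
      then show False using less.hyps e'x e' by blast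
    qed
  qed
  show ?thesis
  proof
    fix e assume e: "e \<in> x"
    obtain v w where vw: "e = (v, w)" by (cases e)
    have arc: "(v, w) \<in> parcs T" using path_setD(1)[OF x e] vw by simp
    have "snd e' \<notin> C" if "e' \<in> set (pth w)" for e'
      using out[of e'] path_setD(2)[OF x e] vw that by auto
    then show "e \<in> above_cut C \<times> above_cut C"
      using vw arc in_arcsD1[OF arc] in_arcsD2[OF arc] by (auto simp: above_cut_def pth_arc)
  qed
qed

end

section \<open>Factorials of a rooted tree\<close>

lemma geometric_sum_le:
  assumes "finite N" "0 \<le> q" "q < (1::real)"
  shows "(\<Sum>k\<in>N. q ^ k) \<le> 1 / (1 - q)"
proof -
  have "(\<Sum>k\<in>N. q ^ k) \<le> (\<Sum>k. q ^ k)"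
    using assms by (intro sum_le_suminf summable_geometric) auto
  then show ?thesis using assms by (simp add: suminf_geometric)
qed

lemma common_length_mono:
  assumes "x \<inter> y \<subseteq> x' \<inter> y'" "finite (x' \<inter> y')" "\<And>e. e \<in> x' \<Longrightarrow> 0 \<le> l e"
  shows "common_length l x y \<le> common_length l x' y'"
  unfolding common_length_def
proof (rule sum_mono2)
  fix e assume "e \<in> x' \<inter> y' - x \<inter> y"
  then show "0 \<le> l e" using assms(3) by simp
qed (use assms in simp_all)

context rooted_tree
begin

text \<open>Intersections with a fixed path are nested initial segments. This gives the ultrametric
  inequality, and an intersection of least cardinality also has least length for any nonnegative
  \<open>l\<close>.\<close>

lemma ultrametric_kernel_common_length:
  assumes pos: "\<And>e. e \<in> parcs T \<Longrightarrow> 0 \<le> l e"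
  shows "ultrametric_kernel boundary (common_length l)"
proof
  show "common_length l x y = common_length l y x" for x y
    by (simp add: common_length_def Int_commute)
next
  fix x y assume "x \<in> boundary"
  then have "x \<subseteq> parcs T" using path_set_boundary path_setD(1) by blast
  then show "0 \<le> common_length l x y"
    unfolding common_length_def using pos by (intro sum_nonneg) auto
next
  fix x y z assume xyz: "x \<in> boundary" "y \<in> boundary" "z \<in> boundary" "x \<noteq> y" "y \<noteq> z" "x \<noteq> z"
  have pos': "\<And>e. e \<in> x \<Longrightarrow> 0 \<le> l e"
    using xyz path_set_boundary path_setD(1) pos by blast
  have "y \<inter> x \<subseteq> z \<or> y \<inter> z \<subseteq> x" using xyz by (intro path_set_nested path_set_boundary)
  then have "common_length l x y \<le> common_length l x z \<or> common_length l y z \<le> common_length l x z"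
    using common_length_mono[of x y x z l] common_length_mono[of y z x z l] pos'
      finite_boundary_Int[of x z] xyz by blast
  then show "min (common_length l x y) (common_length l y z) \<le> common_length l x z" by auto
next
  fix y X assume y: "y \<in> boundary" and X: "X \<subseteq> boundary - {y}" "X \<noteq> {}"
  obtain x where x: "x \<in> X" "\<And>x'. x' \<in> X \<Longrightarrow> card (x \<inter> y) \<le> card (x' \<inter> y)"
  proof -
    obtain x0 where "x0 \<in> X" using X by blast
    then have "\<exists>x. x \<in> X \<and> (\<forall>x'. x' \<in> X \<longrightarrow> card (x \<inter> y) \<le> card (x' \<inter> y))"
      by (rule ex_has_least_nat)
    then show ?thesis using that by blast
  qed
  have "common_length l x y \<le> common_length l x' y" if x': "x' \<in> X" for x'
  proof -
    have b: "x \<in> boundary" "x' \<in> boundary" "x \<noteq> y" "x' \<noteq> y" using X x x' by auto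
    have fin: "finite (x \<inter> y)" "finite (x' \<inter> y)" using b y by (auto intro: finite_boundary_Int)
    have "y \<inter> x \<subseteq> x' \<or> y \<inter> x' \<subseteq> x" using b y by (intro path_set_nested path_set_boundary)
    then have "x \<inter> y \<subseteq> x' \<inter> y"
    proof
      assume "y \<inter> x' \<subseteq> x"
      then have "x' \<inter> y \<subseteq> x \<inter> y" by blast
      then have "x' \<inter> y = x \<inter> y" using card_seteq[OF fin(1)] x(2)[OF x'] by blast
      then show ?thesis by simp
    qed blast
    then show ?thesis
      using fin b path_set_boundary path_setD(1) pos by (intro common_length_mono) blast+
  qed
  then show "\<exists>x\<in>X. \<forall>x'\<in>X. common_length l x y \<le> common_length l x' y" using x by blast
qed

text \<open>The \<open>SOME\<close> in \<open>tree_factorial\<close> yields a greedy sequence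
  because one exists. The bounds below are proved for every greedy sequence, hence for this
  one.\<close>

lemma tree_factorial_eq_cost:
  assumes pos: "\<And>e. e \<in> parcs T \<Longrightarrow> 0 \<le> l e" and inf: "infinite boundary"
  obtains \<rho> where "greedy_kernel boundary (common_length l) \<rho>"
    "tree_factorial T r l = greedy_kernel.cost (common_length l) \<rho>"
proof -
  interpret K: ultrametric_kernel boundary "common_length l"
    using pos by (rule ultrametric_kernel_common_length)
  have eq: "K.greedy = greedy_sequence T r l"
    by (simp add: fun_eq_iff K.greedy_def greedy_sequence_def)
  define \<rho> where "\<rho> = (SOME \<rho>. greedy_sequence T r l \<rho>)"
  have "\<exists>\<rho>. greedy_sequence T r l \<rho>" using K.ex_greedy[OF inf] unfolding eq .
  then have "greedy_sequence T r l \<rho>" unfolding \<rho>_def by (rule someI_ex)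
  then interpret G: greedy_kernel boundary "common_length l" \<rho>
    by unfold_locales (simp add: eq)
  have "tree_factorial T r l n = G.cost n" for n
    unfolding tree_factorial_def Let_def \<rho>_def[symmetric] G.cost_def ..
  then have "tree_factorial T r l = G.cost" by (rule ext)
  then show ?thesis using that G.greedy_kernel_axioms by blast
qed

definition visits :: "(nat \<Rightarrow> ('a \<times> 'a) set) \<Rightarrow> nat \<Rightarrow> 'a \<Rightarrow> nat" where
  "visits \<rho> n v = card {j. j < n \<and> v \<in> snd ` \<rho> j}"

end

section \<open>Counting the visits of greedy paths to vertices\<close>

locale greedy_tree = rooted_tree T r + greedy_kernel "extended_boundary T r" "common_length l" \<rho>
  for T :: "'a pair_pre_digraph" and r :: 'a and l :: "'a \<times> 'a \<Rightarrow> real"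
    and \<rho> :: "nat \<Rightarrow> ('a \<times> 'a) set" +
  assumes length_nonneg: "\<And>e. e \<in> parcs T \<Longrightarrow> 0 \<le> l e"
begin

lemma path_set_\<rho>: "path_set (\<rho> j)"
  by (rule path_set_boundary) (rule \<rho>_in)

lemma arc_in_\<rho>_iff:
  assumes arc: "(u, v) \<in> parcs T"
  shows "v \<in> snd ` \<rho> j \<longleftrightarrow> (u, v) \<in> \<rho> j"
proof
  assume "v \<in> snd ` \<rho> j"
  then obtain u' where u': "(u', v) \<in> \<rho> j" by auto
  then have "(u', v) \<in> parcs T" by (rule path_setD(1)[OF path_set_\<rho>])
  then show "(u, v) \<in> \<rho> j" using u' arc_parent_unique[OF arc] by blast
next
  assume "(u, v) \<in> \<rho> j"
  then show "v \<in> snd ` \<rho> j" by (rule image_eqI[rotated]) simp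
qed

text \<open>
  The last of the first \<open>n\<close> paths through the arc has the arc in common with all earlier ones, and
  its cost is at most that of \<open>\<rho> n\<close>.
\<close>

lemma visits_le_cost:
  assumes arc: "(u, v) \<in> parcs T"
  shows "l (u, v) * (real (visits \<rho> n v) - 1) \<le> cost n"
proof (cases "visits \<rho> n v = 0")
  case True
  then show ?thesis using cost_nonneg[of n] length_nonneg[OF arc] by simp
next
  case False
  define J where "J = {j. j < n \<and> v \<in> snd ` \<rho> j}"
  have fin: "finite J" by (simp add: J_def)
  have cardJ: "card J = visits \<rho> n v" by (simp add: J_def visits_def)
  then have "J \<noteq> {}" using False by auto
  define m where "m = Max J"
  have m: "m \<in> J" "\<And>j. j \<in> J \<Longrightarrow> j \<le> m" using fin \<open>J \<noteq> {}\<close> by (auto simp: m_def)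
  have "real (card (J - {m})) * l (u, v) = (\<Sum>j\<in>J - {m}. l (u, v))" by simp
  also have "\<dots> \<le> (\<Sum>j\<in>J - {m}. common_length l (\<rho> m) (\<rho> j))"
  proof (rule sum_mono)
    fix j assume j: "j \<in> J - {m}"
    then have "(u, v) \<in> \<rho> m \<inter> \<rho> j" using m arc by (simp add: J_def arc_in_\<rho>_iff)
    moreover have "finite (\<rho> m \<inter> \<rho> j)"
      using j inj_\<rho> by (intro finite_boundary_Int \<rho>_in) (auto dest: injD)
    moreover have "0 \<le> l e" if "e \<in> \<rho> m" for e
      using that path_setD(1)[OF path_set_\<rho>[of m]] length_nonneg by blast
    ultimately show "l (u, v) \<le> common_length l (\<rho> m) (\<rho> j)"
      unfolding common_length_def using member_le_sum[of "(u, v)" "\<rho> m \<inter> \<rho> j" l] by blast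
  qed
  also have "\<dots> \<le> cost m"
    unfolding cost_def
  proof (rule sum_mono2)
    show "J - {m} \<subseteq> {..<m}" using m(2) by (auto simp: le_less)
  qed (simp_all add: nonneg[OF \<rho>_in \<rho>_in])
  also have "\<dots> \<le> cost n" using m by (intro cost_mono) (simp add: J_def)
  finally have "real (card (J - {m})) * l (u, v) \<le> cost n" .
  moreover have "card (J - {m}) = visits \<rho> n v - 1" using m(1) cardJ by (simp add: fin)
  then have "real (card (J - {m})) = real (visits \<rho> n v) - 1" using False by linarith
  ultimately show ?thesis by (simp only: mult.commute)
qed

lemma finite_inside:
  assumes "finite A"
  shows "\<exists>K. \<forall>n. card {j. j < n \<and> \<rho> j \<subseteq> A} \<le> K"
proof (intro exI allI)
  fix n
  have "card {j. j < n \<and> \<rho> j \<subseteq> A} = card (\<rho> ` {j. j < n \<and> \<rho> j \<subseteq> A})"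
    by (rule card_image[OF inj_on_subset[OF inj_\<rho> subset_UNIV], symmetric])
  also have "\<dots> \<le> card (Pow A)" using assms by (intro card_mono) auto
  finally show "card {j. j < n \<and> \<rho> j \<subseteq> A} \<le> card (Pow A)" .
qed

text \<open>Paths missing the minimal cut lie in a finite set of arcs and are distinct, so their
  number is bounded independently of \<open>n\<close>. Every other path is counted at least once in
  the sum.\<close>

lemma visits_cut_set_ge:
  assumes lf: "locally_finite T" and C: "cut_set T r C" "r \<notin> C"
  shows "\<exists>K. \<forall>n. real n \<le> K + (\<Sum>v\<in>min_cut C. real (visits \<rho> n v))"
proof -
  define A where "A = above_cut C \<times> above_cut C"
  have "finite A" using finite_above_cut[OF assms] by (simp add: A_def)
  then obtain K where K: "\<And>n. card {j. j < n \<and> \<rho> j \<subseteq> A} \<le> K" using finite_inside by blast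
  have "real n \<le> real K + (\<Sum>v\<in>min_cut C. real (visits \<rho> n v))" for n
  proof -
    have "{..<n} \<subseteq> {j. j < n \<and> \<rho> j \<subseteq> A} \<union> (\<Union>v\<in>min_cut C. {j. j < n \<and> v \<in> snd ` \<rho> j})"
      using path_set_above_cut[OF path_set_\<rho>, of _ C] unfolding A_def by blast
    then have "card {..<n} \<le>
        card ({j. j < n \<and> \<rho> j \<subseteq> A} \<union> (\<Union>v\<in>min_cut C. {j. j < n \<and> v \<in> snd ` \<rho> j}))"
      using finite_min_cut[OF assms] by (intro card_mono) auto
    also have "\<dots> \<le> card {j. j < n \<and> \<rho> j \<subseteq> A} +
        card (\<Union>v\<in>min_cut C. {j. j < n \<and> v \<in> snd ` \<rho> j})"
      by (rule card_Un_le)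
    also have "\<dots> \<le> K + (\<Sum>v\<in>min_cut C. visits \<rho> n v)"
      unfolding visits_def
      by (rule add_mono[OF K card_UN_le[OF finite_min_cut[OF assms]]])
    finally have "n \<le> K + (\<Sum>v\<in>min_cut C. visits \<rho> n v)" by simp
    then show ?thesis by (metis of_nat_le_iff of_nat_add of_nat_sum)
  qed
  then show ?thesis by blast
qed

text \<open>A path enters the minimal elements at most once, so the index sets counted are
  disjoint.\<close>

lemma sum_visits_min_cut_le:
  assumes "finite F" "F \<subseteq> min_cut C"
  shows "(\<Sum>v\<in>F. visits \<rho> n v) \<le> n"
proof -
  have "(\<Sum>v\<in>F. visits \<rho> n v) = card (\<Union>v\<in>F. {j. j < n \<and> v \<in> snd ` \<rho> j})"
    unfolding visits_def
  proof (rule card_UN_disjoint[symmetric])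
    show "\<forall>v\<in>F. \<forall>w\<in>F. v \<noteq> w \<longrightarrow>
        {j. j < n \<and> v \<in> snd ` \<rho> j} \<inter> {j. j < n \<and> w \<in> snd ` \<rho> j} = {}"
    proof (intro ballI impI equals0I)
      fix v w j assume vw: "v \<in> F" "w \<in> F" "v \<noteq> w"
        and "j \<in> {j. j < n \<and> v \<in> snd ` \<rho> j} \<inter> {j. j < n \<and> w \<in> snd ` \<rho> j}"
      then obtain u u' where "(u, v) \<in> \<rho> j" "(u', w) \<in> \<rho> j" by auto
      moreover have "v \<in> min_cut C" "w \<in> min_cut C" using vw assms(2) by blast+
      ultimately have "(u, v) = (u', w)"
        using min_cut_arc_unique[OF path_set_\<rho>, of "(u, v)" j "(u', w)" C] by simp
      then show False using vw by simp
    qed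
  qed (use assms in auto)
  also have "\<dots> \<le> card {..<n}" by (intro card_mono) auto
  finally show ?thesis by simp
qed

end

section \<open>Geometric lengths and the branching number\<close>

context rooted_tree
begin

lemma geometric_length_arc: "geometric_length T r lam (u, v) = lam ^ level u"
  by (simp add: geometric_length_def)

lemma level_powi_arc:
  fixes lam :: real
  assumes "(u, v) \<in> parcs T" "lam > 0"
  shows "lam powi (- int (level v)) = 1 / (lam * lam ^ level u)"
  unfolding level_arc[OF assms(1)]
  by (simp only: power_int_minus power_int_of_nat power_Suc inverse_eq_divide)

lemma arc_to_vertex:
  assumes "v \<in> pverts T" "v \<noteq> r"
  obtains u where "(u, v) \<in> parcs T"
  using reachable_root[OF assms(1)] assms(2) by (auto elim: rtranclE)

text \<open>A path has at most one arc starting at each level, so the common arcs contribute at most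
  a geometric series.\<close>

lemma boundary_common_length_le:
  assumes x: "x \<in> boundary" "y \<in> boundary" "x \<noteq> y" and lam: "0 < lam" "lam < 1"
  shows "common_length (geometric_length T r lam) x y \<le> 1 / (1 - lam)"
proof -
  have ps: "path_set x" by (rule path_set_boundary) (rule x)
  have inj: "inj_on (\<lambda>e. level (fst e)) (x \<inter> y)"
  proof (rule inj_onI)
    fix e e' assume e: "e \<in> x \<inter> y" "e' \<in> x \<inter> y" "level (fst e) = level (fst e')"
    then have "level (snd e) = Suc (level (fst e))" "level (snd e') = Suc (level (fst e'))"
      using path_setD(1)[OF ps, of e] path_setD(1)[OF ps, of e'] e(1,2)
        level_arc[of "fst e" "snd e"] level_arc[of "fst e'" "snd e'"] by simp_all
    then show "e = e'" using e by (intro path_set_level_inj[OF ps]) simp_all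
  qed
  have "common_length (geometric_length T r lam) x y = (\<Sum>e\<in>x \<inter> y. lam ^ level (fst e))"
    unfolding common_length_def by (intro sum.cong refl) (auto simp: geometric_length_def)
  also have "\<dots> = (\<Sum>k\<in>(\<lambda>e. level (fst e)) ` (x \<inter> y). lam ^ k)"
    by (simp add: sum.reindex[OF inj])
  also have "\<dots> \<le> 1 / (1 - lam)"
    using lam finite_boundary_Int[OF x] by (intro geometric_sum_le) auto
  finally show ?thesis .
qed

end

section \<open>Linear bounds on costs versus lower bounds on cut-set sums\<close>

locale greedy_geometric_tree = greedy_tree T r "geometric_length T r lam" \<rho>
  for T :: "'a pair_pre_digraph" and r :: 'a and lam :: real
    and \<rho> :: "nat \<Rightarrow> ('a \<times> 'a) set" +
  assumes lam_pos: "0 < lam"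
begin

lemma cost_le_of_less_1:
  assumes "lam < 1"
  shows "cost n \<le> 1 / (1 - lam) * real n"
proof -
  have "cost n \<le> (\<Sum>j<n. 1 / (1 - lam))"
    unfolding cost_def
  proof (rule sum_mono)
    fix j assume "j \<in> {..<n}"
    then have "\<rho> n \<noteq> \<rho> j" using injD[OF inj_\<rho>, of n j] by auto
    then show "common_length (geometric_length T r lam) (\<rho> n) (\<rho> j) \<le> 1 / (1 - lam)"
      using assms lam_pos by (intro boundary_common_length_le \<rho>_in)
  qed
  then show ?thesis by simp
qed

text \<open>
  All but boundedly many of the first \<open>n\<close> paths cross the cut, while by \<open>visits_le_cost\<close> the
  number of those through \<open>v\<close> is at most one plus \<open>M n\<close> divided by the length of the arc into \<open>v\<close>.
\<close>

lemma cut_sum_ge: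
  assumes lf: "locally_finite T" and C: "cut_set T r C"
    and M: "0 < M" "\<And>n. cost n \<le> M * real n"
  shows "ennreal (min 1 (1 / (M * lam))) \<le>
    (\<Sum>\<^sub>\<infinity>v\<in>C. ennreal (lam powi (- int (level v))))"
proof (cases "r \<in> C")
  \<comment> \<open>The root alone contributes 1, which explains the 1 in the minimum.\<close>
  case True
  have "ennreal (min 1 (1 / (M * lam))) \<le> ennreal 1"
    by (intro ennreal_leI) simp
  also have "\<dots> = (\<Sum>\<^sub>\<infinity>v\<in>{r}. ennreal (lam powi (- int (level v))))" by simp
  also have "\<dots> \<le> (\<Sum>\<^sub>\<infinity>v\<in>C. ennreal (lam powi (- int (level v))))"
    using True by (intro infsum_mono_neutral nonneg_summable_on_complete) auto
  finally show ?thesis .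
next
  case False
  define D where "D = min_cut C"
  have fin: "finite D" unfolding D_def using lf C False by (rule finite_min_cut)
  define Z where "Z = (\<Sum>v\<in>D. lam powi (- int (level v)))"
  obtain K where K: "\<And>n. real n \<le> K + (\<Sum>v\<in>D. real (visits \<rho> n v))"
    using visits_cut_set_ge[OF lf C False] unfolding D_def by blast
  \<comment> \<open>The arc length is read off at the tail \<open>u\<close>, the weight at the head
    \<open>v\<close> one level deeper; this shift produces the factor \<open>lam\<close>.\<close>
  have visit: "real (visits \<rho> n v) \<le> 1 + M * lam * real n * (lam powi (- int (level v)))"
    if v: "v \<in> D" for n v
  proof -
    have "v \<in> pverts T" "v \<noteq> r" using v C False min_cut_subset unfolding D_def cut_set_def by blast+
    then obtain u where u: "(u, v) \<in> parcs T" by (rule arc_to_vertex)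
    have "lam ^ level u * (real (visits \<rho> n v) - 1) \<le> M * real n"
      using visits_le_cost[OF u, of n] M(2)[of n] by (simp add: geometric_length_arc)
    then have "real (visits \<rho> n v) - 1 \<le> M * real n / lam ^ level u"
      using lam_pos by (simp add: field_simps)
    also have "\<dots> = M * lam * real n * (lam powi (- int (level v)))"
      using lam_pos unfolding level_powi_arc[OF u lam_pos] by simp
    finally show ?thesis by simp
  qed
  have bound: "real n \<le> K + real (card D) + M * lam * Z * real n" for n
  proof -
    have "(\<Sum>v\<in>D. real (visits \<rho> n v)) \<le>
        (\<Sum>v\<in>D. 1 + M * lam * real n * (lam powi (- int (level v))))"
      using visit by (rule sum_mono)
    also have "\<dots> = real (card D) + M * lam * Z * real n"
      by (simp add: sum.distrib Z_def sum_distrib_left sum_distrib_right mult_ac)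
    finally show ?thesis using K[of n] by simp
  qed
  \<comment> \<open>The linear bound holds for all \<open>n\<close> with a fixed constant term, so
    its slope is at least 1.\<close>
  have "1 \<le> M * lam * Z"
  proof (rule ccontr)
    assume "\<not> ?thesis"
    then have pos: "0 < 1 - M * lam * Z" by simp
    obtain n :: nat where n: "K + real (card D) < real n * (1 - M * lam * Z)"
      using reals_Archimedean3[OF pos] by blast
    then show False using bound[of n] by (simp add: algebra_simps)
  qed
  then have "1 / (M * lam) \<le> Z" using M(1) lam_pos by (simp add: field_simps)
  then have "ennreal (min 1 (1 / (M * lam))) \<le> ennreal Z" by (intro ennreal_leI) simp
  also have "\<dots> = (\<Sum>\<^sub>\<infinity>v\<in>D. ennreal (lam powi (- int (level v))))"
    unfolding Z_def using fin lam_pos by (simp add: sum_ennreal)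
  also have "\<dots> \<le> (\<Sum>\<^sub>\<infinity>v\<in>C. ennreal (lam powi (- int (level v))))"
    using min_cut_subset[of C]
    by (intro infsum_mono_neutral nonneg_summable_on_complete) (auto simp: D_def)
  finally show ?thesis .
qed

text \<open>
  Otherwise the vertices visited too often by the first \<open>n\<close> paths form a cut-set: along a ray that
  avoids them the total length in common with these paths is a small geometric series.
\<close>

lemma cost_le_of_cut_sum_ge:
  assumes mu: "lam < mu" "1 < mu" and eps: "0 < eps"
    and cut: "\<And>C. cut_set T r C \<Longrightarrow>
      ennreal eps \<le> (\<Sum>\<^sub>\<infinity>v\<in>C. ennreal (mu powi (- int (level v))))"
  shows "cost n \<le> 2 / eps / (mu - lam) * real n"
proof (rule ccontr)
  assume less: "\<not> ?thesis"
  \<comment> \<open>Chosen so that the sum over the minimal elements of \<open>C\<close>, at most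
    \<open>1 / K\<close>, is only half of \<open>eps\<close>.\<close>
  define K where "K = 2 / eps"
  have Kpos: "0 < K" using eps by (simp add: K_def)
  have npos: "0 < n" using less by (cases n) (simp_all add: cost_def)
  define C where "C = {v \<in> pverts T - {r}. K * real n < mu ^ level v * real (visits \<rho> n v)}"
  have "cut_set T r C"
    unfolding cut_set_def
  proof (intro conjI allI impI notI)
    show "C \<subseteq> pverts T" by (auto simp: C_def)
  next
    fix f assume f: "ray T r f" and "range f \<inter> C = {}"
    then have out: "f (Suc k) \<notin> C" for k by blast
    have few: "mu ^ Suc k * real (visits \<rho> n (f (Suc k))) \<le> K * real n" for k
      using out[of k] ray_in_verts[OF f, of "Suc k"] arc_not_root[OF ray_Suc[OF f, of k]]
        level_ray[OF f, of "Suc k"] by (simp add: C_def)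
    define arc where "arc k = (f k, f (Suc k))" for k
    define x where "x = range arc"
    have x_in: "x \<in> boundary" using ray_in_boundary[OF f] by (simp add: x_def arc_def)
    have inj_arc: "inj arc"
    proof (rule injI)
      fix i j assume "arc i = arc j"
      then have "level (f i) = level (f j)" by (simp add: arc_def)
      then show "i = j" by (simp add: level_ray[OF f])
    qed
    have arc_T: "arc k \<in> parcs T" for k using ray_Suc[OF f] by (simp add: arc_def)
    have visits_arc: "visits \<rho> n (f (Suc k)) = card {j \<in> {..<n}. arc k \<in> \<rho> j}" for k
      unfolding visits_def using arc_in_\<rho>_iff[OF arc_T[of k, unfolded arc_def]]
      by (simp add: arc_def)
    \<comment> \<open>The greedy choice can be compared only with a path not yet used. A used ray
      would visit each of its own vertices, forcing \<open>mu ^ Suc k \<le> K * real n\<close> for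
      every \<open>k\<close>, against \<open>1 < mu\<close>.\<close>
    have fresh: "x \<notin> \<rho> ` {..<n}"
    proof
      assume "x \<in> \<rho> ` {..<n}"
      then obtain i where i: "i < n" "x = \<rho> i" by auto
      have "1 \<le> visits \<rho> n (f (Suc k))" for k
      proof -
        have "i \<in> {j \<in> {..<n}. arc k \<in> \<rho> j}" using i by (auto simp flip: i(2) simp: x_def)
        then have "card {j \<in> {..<n}. arc k \<in> \<rho> j} \<noteq> 0" by auto
        then show ?thesis unfolding visits_arc by linarith
      qed
      then have "mu ^ Suc k * 1 \<le> mu ^ Suc k * real (visits \<rho> n (f (Suc k)))" for k
        using mu by (intro mult_left_mono) auto
      then have "mu ^ Suc k \<le> K * real n" for k using few[of k] by (metis mult.right_neutral order_trans)
      moreover obtain k where "K * real n < mu ^ k" using real_arch_pow[OF mu(2)] by blast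
      moreover have "mu ^ k \<le> mu ^ Suc k" using mu by (intro power_increasing) auto
      ultimately show False by (meson not_less order_trans)
    qed
    have "finite (\<Union>j<n. x \<inter> \<rho> j)"
      using fresh by (intro finite_UN_I finite_boundary_Int x_in \<rho>_in) auto
    \<comment> \<open>One finite index set covers the arcs shared with any of the first
      \<open>n\<close> paths, so that lengths can be counted by arcs instead of by paths.\<close>
    then obtain N where N: "finite N" "(\<Union>j<n. x \<inter> \<rho> j) = arc ` N"
      using finite_subset_image[of "\<Union>j<n. x \<inter> \<rho> j" arc UNIV] by (auto simp: x_def)
    have "common_length (geometric_length T r lam) x (\<rho> j)
        = (\<Sum>k\<in>N. if arc k \<in> \<rho> j then lam ^ k else 0)" if j: "j < n" for j
    proof -
      have "x \<inter> \<rho> j = arc ` {k \<in> N. arc k \<in> \<rho> j}"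
      proof (intro equalityI subsetI)
        fix e assume e: "e \<in> x \<inter> \<rho> j"
        then have "e \<in> arc ` N" using N(2) j by blast
        then show "e \<in> arc ` {k \<in> N. arc k \<in> \<rho> j}" using e by blast
      qed (auto simp: x_def)
      then have "common_length (geometric_length T r lam) x (\<rho> j)
          = (\<Sum>k\<in>{k \<in> N. arc k \<in> \<rho> j}. geometric_length T r lam (arc k))"
        unfolding common_length_def by (simp add: sum.reindex inj_on_subset[OF inj_arc])
      also have "\<dots> = (\<Sum>k\<in>{k \<in> N. arc k \<in> \<rho> j}. lam ^ k)"
        by (simp add: arc_def geometric_length_arc level_ray[OF f])
      also have "\<dots> = (\<Sum>k\<in>N. if arc k \<in> \<rho> j then lam ^ k else 0)"
        using N(1) by (rule sum.inter_filter)
      finally show ?thesis .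
    qed
    then have "(\<Sum>j<n. common_length (geometric_length T r lam) x (\<rho> j))
        = (\<Sum>j<n. \<Sum>k\<in>N. if arc k \<in> \<rho> j then lam ^ k else 0)" by simp
    also have "\<dots> = (\<Sum>k\<in>N. \<Sum>j<n. if arc k \<in> \<rho> j then lam ^ k else 0)" by (rule sum.swap)
    also have "\<dots> = (\<Sum>k\<in>N. real (visits \<rho> n (f (Suc k))) * lam ^ k)"
      by (simp add: visits_arc flip: sum.inter_filter)
    \<comment> \<open>The \<open>k\<close>-th arc has length \<open>lam ^ k\<close> but ends at
      level \<open>Suc k\<close>, whence the extra division by \<open>mu\<close>.\<close>
    also have "\<dots> \<le> (\<Sum>k\<in>N. K * real n / mu * (lam / mu) ^ k)"
    proof (rule sum_mono)
      fix k
      have "real (visits \<rho> n (f (Suc k))) \<le> K * real n / mu ^ Suc k"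
        using few[of k] mu by (simp add: pos_le_divide_eq mult.commute)
      then have "real (visits \<rho> n (f (Suc k))) * lam ^ k \<le> K * real n / mu ^ Suc k * lam ^ k"
        using lam_pos by (intro mult_right_mono) auto
      also have "\<dots> = K * real n / mu * (lam / mu) ^ k" by (simp add: power_divide)
      finally show "real (visits \<rho> n (f (Suc k))) * lam ^ k \<le> K * real n / mu * (lam / mu) ^ k" .
    qed
    also have "\<dots> = K * real n / mu * (\<Sum>k\<in>N. (lam / mu) ^ k)" by (simp add: sum_distrib_left)
    also have "\<dots> \<le> K * real n / mu * (1 / (1 - lam / mu))"
      using Kpos mu lam_pos N(1) by (intro mult_left_mono geometric_sum_le) auto
    also have "1 - lam / mu = (mu - lam) / mu" using mu by (simp add: diff_divide_distrib)
    also have "K * real n / mu * (1 / ((mu - lam) / mu)) = 2 / eps / (mu - lam) * real n"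
      using mu by (simp add: K_def)
    finally have "(\<Sum>j<n. common_length (geometric_length T r lam) x (\<rho> j))
        \<le> 2 / eps / (mu - lam) * real n" .
    then show False using cost_le[OF x_in fresh] less by linarith
  qed
  then have "ennreal eps \<le> (\<Sum>\<^sub>\<infinity>v\<in>min_cut C. ennreal (mu powi (- int (level v))))"
    by (intro cut cut_set_min_cut)
  \<comment> \<open>It suffices to bound finite partial sums. Membership in \<open>C\<close> bounds
    each weight by a multiple of the visits, and these add up to at most \<open>n\<close>.\<close>
  also have "\<dots> \<le> ennreal (1 / K)"
  proof (rule infsum_le_finite_sums)
    fix F assume F: "finite F" "F \<subseteq> min_cut C"
    have "mu powi (- int (level v)) \<le> real (visits \<rho> n v) / (K * real n)" if "v \<in> F" for v
    proof -
      have "v \<in> C" using that F min_cut_subset by blast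
      then have "K * real n < mu ^ level v * real (visits \<rho> n v)" by (simp add: C_def)
      then show ?thesis using mu Kpos npos by (simp add: power_int_minus field_simps)
    qed
    then have "(\<Sum>v\<in>F. mu powi (- int (level v))) \<le> (\<Sum>v\<in>F. real (visits \<rho> n v) / (K * real n))"
      by (rule sum_mono)
    also have "\<dots> = real (\<Sum>v\<in>F. visits \<rho> n v) / (K * real n)"
      by (simp add: sum_divide_distrib)
    also have "\<dots> \<le> real n / (K * real n)"
      using sum_visits_min_cut_le[OF F, of n] Kpos
      by (intro divide_right_mono of_nat_mono) simp_all
    also have "\<dots> = 1 / K" using npos by simp
    finally have "ennreal (\<Sum>v\<in>F. mu powi (- int (level v))) \<le> ennreal (1 / K)"
      by (rule ennreal_leI)
    then show "(\<Sum>v\<in>F. ennreal (mu powi (- int (level v)))) \<le> ennreal (1 / K)"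
      using mu by (simp add: sum_ennreal)
  qed (simp add: nonneg_summable_on_complete)
  also have "\<dots> < ennreal eps" using eps by (simp add: K_def ennreal_lessI)
  finally show False by simp
qed

end

theorem theorem1p11:
  fixes T :: "'a pair_pre_digraph" and r :: 'a
  assumes "rooted_tree T r"
    and "countable (pverts T)"
    and "infinite (pverts T)"
    and "locally_finite T"
    and "infinite {v. branching T v}"
  shows "branching_number T r =
    Sup (ereal ` {lam. lam > 0 \<and>
      (\<exists>L. L < \<infinity> \<and>
        (\<lambda>n. ereal (tree_factorial T r (geometric_length T r lam) n / real n)) \<longlonglongrightarrow> L)})"
    (is "_ = Sup (ereal ` ?B)")
proof -
  interpret rooted_tree T r by fact
  have inf: "infinite boundary" using assms by (intro infinite_boundary)
  let ?w = "\<lambda>lam C. \<Sum>\<^sub>\<infinity>v\<in>C. ennreal (lam powi (- int (level v)))"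
  let ?A = "{lam. lam > 0 \<and> (INF C \<in> {C. cut_set T r C}. ?w lam C) > 0}"
  have ex_greedy: "\<exists>\<rho>. greedy_geometric_tree T r lam \<rho> \<and>
      tree_factorial T r (geometric_length T r lam)
        = greedy_kernel.cost (common_length (geometric_length T r lam)) \<rho>"
    if lam: "lam > 0" for lam
  proof -
    have pos: "0 \<le> geometric_length T r lam e" for e
      using lam by (cases e) (simp add: geometric_length_def)
    obtain \<rho> where \<rho>: "greedy_kernel boundary (common_length (geometric_length T r lam)) \<rho>"
      "tree_factorial T r (geometric_length T r lam)
        = greedy_kernel.cost (common_length (geometric_length T r lam)) \<rho>"
      using tree_factorial_eq_cost[OF _ inf] pos by metis
    interpret greedy_kernel boundary "common_length (geometric_length T r lam)" \<rho> by (rule \<rho>(1))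
    have "greedy_geometric_tree T r lam \<rho>" by unfold_locales (use pos lam in auto)
    then show ?thesis using \<rho>(2) by blast
  qed
  \<comment> \<open>A linear bound already yields a finite limit, since bounded superadditive
    averages converge.\<close>
  have bounded_in_B: "lam \<in> ?B"
    if lam: "lam > 0" and bound: "\<And>\<rho>. greedy_geometric_tree T r lam \<rho> \<Longrightarrow>
      \<exists>M. \<forall>n. greedy_kernel.cost (common_length (geometric_length T r lam)) \<rho> n \<le> M * real n"
    for lam
  proof -
    obtain \<rho> where \<rho>: "greedy_geometric_tree T r lam \<rho>"
      "tree_factorial T r (geometric_length T r lam)
        = greedy_kernel.cost (common_length (geometric_length T r lam)) \<rho>"
      using ex_greedy[OF lam] by blast
    interpret G: greedy_geometric_tree T r lam \<rho> by (rule \<rho>(1))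
    obtain M where "\<And>n. G.cost n \<le> M * real n" using bound[OF \<rho>(1)] by blast
    then obtain L where "(\<lambda>n. G.cost n / real n) \<longlonglongrightarrow> L" using G.cost_div_convergent by blast
    then have "(\<lambda>n. ereal (G.cost n / real n)) \<longlonglongrightarrow> ereal L" by simp
    then show ?thesis using lam
      by (intro CollectI conjI exI[of _ "ereal L"]) (simp_all only: \<rho>(2) less_ereal.simps)
  qed
  have B_subset: "?B \<subseteq> ?A"
  proof
    fix lam assume "lam \<in> ?B"
    then obtain L where lam: "lam > 0" and L: "L < \<infinity>"
      "(\<lambda>n. ereal (tree_factorial T r (geometric_length T r lam) n / real n)) \<longlonglongrightarrow> L"
      by blast
    obtain \<rho> where \<rho>: "greedy_geometric_tree T r lam \<rho>"
      "tree_factorial T r (geometric_length T r lam)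
        = greedy_kernel.cost (common_length (geometric_length T r lam)) \<rho>"
      using ex_greedy[OF lam] by blast
    interpret G: greedy_geometric_tree T r lam \<rho> by (rule \<rho>(1))
    obtain M :: real where M: "L < ereal M"
      using ereal_dense2[OF L(1)] by blast
    have "\<forall>\<^sub>F n in sequentially. ereal (G.cost n / real n) < ereal M"
      using L(2) M unfolding \<rho>(2) by (rule order_tendstoD(2))
    then obtain N where N: "\<And>n. n \<ge> N \<Longrightarrow> G.cost n / real n < M"
      by (auto simp: eventually_sequentially)
    \<comment> \<open>Superadditivity turns the eventual bound into one for all \<open>n\<close>.\<close>
    have "G.cost n \<le> max 1 M * real n" for n
    proof (cases "n = 0")
      case True
      then show ?thesis by (simp add: G.cost_def)
    next
      case False
      \<comment> \<open>Positive, and large enough that \<open>q * n\<close> reaches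
        \<open>N\<close> for every \<open>n \<ge> 1\<close>.\<close>
      define q where "q = Suc N"
      have "N \<le> q * n" using False by (cases n) (auto simp: q_def)
      then have "G.cost (q * n) / real (q * n) < M" by (rule N)
      then have "G.cost (q * n) < M * real (q * n)"
        using False by (simp add: pos_divide_less_eq q_def del: of_nat_Suc of_nat_mult)
      then have "real q * G.cost n \<le> real q * (M * real n)"
        using G.cost_mult[of q n] by (simp add: mult_ac)
      then have "G.cost n \<le> M * real n" by (simp add: q_def)
      \<comment> \<open>\<open>cut_sum_ge\<close> takes a positive constant, hence the maximum with
        1.\<close>
      also have "\<dots> \<le> max 1 M * real n" by (intro mult_right_mono) auto
      finally show ?thesis .
    qed
    then have "ennreal (min 1 (1 / (max 1 M * lam))) \<le> ?w lam C" if "cut_set T r C" for C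
      using that assms(4) by (intro G.cut_sum_ge) auto
    then have "ennreal (min 1 (1 / (max 1 M * lam))) \<le> (INF C \<in> {C. cut_set T r C}. ?w lam C)"
      by (intro INF_greatest) auto
    moreover have "0 < ennreal (min 1 (1 / (max 1 M * lam)))" using lam by (simp add: less_max_iff_disj)
    ultimately show "lam \<in> ?A" using lam less_le_trans by blast
  qed
  have below_in_B: "lam \<in> ?B" if mu: "mu \<in> ?A" and lam: "0 < lam" "lam < mu" for lam mu
  proof (rule bounded_in_B[OF lam(1)])
    fix \<rho> assume "greedy_geometric_tree T r lam \<rho>"
    then interpret G: greedy_geometric_tree T r lam \<rho> .
    show "\<exists>M. \<forall>n. G.cost n \<le> M * real n"
    \<comment> \<open>Small \<open>lam\<close> are bounded directly. For \<open>lam \<ge> 1\<close>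
      the condition \<open>1 < mu\<close> of \<open>cost_le_of_cut_sum_ge\<close> follows from
      \<open>lam < mu\<close>.\<close>
    proof (cases "lam < 1")
      case True
      then show ?thesis using G.cost_le_of_less_1 by blast
    next
      case False
      define t where "t = (INF C \<in> {C. cut_set T r C}. ?w mu C)"
      have "0 < t" using mu by (simp add: t_def)
      \<comment> \<open>The infimum may be infinite, so a positive real below it is
        extracted.\<close>
      obtain eps where eps: "0 < eps" "ennreal eps \<le> t"
      proof (cases t)
        case (real q)
        then show ?thesis using that[of q] \<open>0 < t\<close> by simp
      next
        case top
        then show ?thesis using that[of 1] by simp
      qed
      have "ennreal eps \<le> ?w mu C" if "cut_set T r C" for C
        using eps(2) that unfolding t_def by (auto intro: order_trans INF_lower)
      then show ?thesis
        using G.cost_le_of_cut_sum_ge[of mu eps] eps(1) lam False by (meson not_less le_less_trans)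
    qed
  qed
  have "Sup (ereal ` ?A) \<le> Sup (ereal ` ?B)"
  proof (rule SUP_least, rule dense_le)
    fix mu z assume mu: "mu \<in> ?A" and z: "z < ereal mu"
    \<comment> \<open>Any \<open>lam\<close> strictly between this maximum and \<open>mu\<close> has
      a finite limit; the 0 keeps \<open>lam\<close> positive.\<close>
    then have "max z 0 < ereal mu" by simp
    then obtain lam where lam: "max z 0 < ereal lam" "ereal lam < ereal mu"
      using ereal_dense2 by blast
    then have "lam \<in> ?B" using below_in_B[OF mu] by simp
    then have "ereal lam \<le> Sup (ereal ` ?B)" by (intro SUP_upper)
    moreover have "z \<le> ereal lam" using lam(1) by (simp add: less_imp_le)
    ultimately show "z \<le> Sup (ereal ` ?B)" by (rule order_trans[rotated])
  qed
  moreover have "Sup (ereal ` ?B) \<le> Sup (ereal ` ?A)"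
    by (rule SUP_subset_mono[OF B_subset]) simp
  ultimately show ?thesis unfolding branching_number_def by (rule antisym)
qed

end
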